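(* Let $E$ be a reflexive Banach lattice and let $F$ be a Dedekind complete Banach lattice. Consider the following conditions: (1) Every positive operator $T: E \to F$ is compact. (2) Every positive operator $T: E \to F$ attains its norm. (3) The set $B_{\mathcal{K}^+(E;F)}$ is sequentially closed in the absolute strong operator topology $|SOT|$ of $\mathcal{L}^r(E;F)$. Then (1)$\Rightarrow$(2)$\Rightarrow$(3). In addition, if the order of $E$ is given by a basis, or if $F$ has order continuous norm and its order is given by a basis, then (3)$\Rightarrow$(1).
   Context: Banach lattices are real. An operator $T:E\to F$ attains its norm if there is $x\in E$ with $\|x\|\le 1$ and $\|T(x)\|=\|T\|$. $\mathcal{L}^r(E;F)$ denotes the space of regular operators from $E$ to $F$ (differences of positive operators); since $F$ is Dedekind complete, each $T\in\mathcal{L}^r(E;F)$ has a modulus $|T|$, and $\mathcal{L}^r(E;F)$ is a Banach lattice with the regular norm $\|T\|_r=\|\,|T|\,\|$. $\mathcal{K}^+(E;F)$ is the set of positive compact operators from $E$ to $F$, and $B_{\mathcal{K}^+(E;F)}$ is the set of those of norm at most $1$ (for positive operators, the regular norm and the operator norm coincide). The absolute strong operator topology $|SOT|$ on $\mathcal{L}^r(E;F)$ is the one with basic neighborhoods $N(T;A,\varepsilon)=\{S\in\mathcal{L}^r(E;F): \|\,|T-S|(x)\,\|<\varepsilon \text{ for every } x\in A\}$, where $A\subset E^+$ is finite and $\varepsilon>0$; thus $T_\alpha\to T$ in $|SOT|$ if and only if $\|\,|T_\alpha-T|(x)\,\|\to 0$ for every $x\in E^+$. A set is sequentially closed in $|SOT|$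 if it contains the $|SOT|$-limit (in $\mathcal{L}^r(E;F)$) of every $|SOT|$-convergent sequence of its elements. The order of a Banach lattice $G$ is given by a basis if $G$ has a Schauder basis $(x_n)_n$ such that the order is coordinatewise: $\sum_n a_nx_n\le\sum_n b_nx_n$ if and only if $a_n\le b_n$ for every $n$. *)

theory Defs
  imports "HOL-Analysis.Analysis" "HOL-Library.Lattice_Algebras"
begin

section \<open>Banach lattices\<close>

text \<open>The modulus on a vector lattice is \<open>\<bar>x\<bar> = sup x (- x)\<close>, fixed by the class
  \<^class>\<open>lattice_ab_group_add_abs\<close>.\<close>

class banach_lattice = banach + ordered_real_vector + lattice_ab_group_add_abs +
  assumes norm_mono_abs: "\<bar>x\<bar> \<le> \<bar>y\<bar> \<Longrightarrow> norm x \<le> norm y"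

text \<open>Dedekind completeness is the sort \<^class>\<open>conditionally_complete_lattice\<close>.\<close>

definition bidual_embedding :: "'a::real_normed_vector \<Rightarrow> ('a \<Rightarrow>\<^sub>L real) \<Rightarrow>\<^sub>L real" where
  "bidual_embedding x = Blinfun (\<lambda>f. blinfun_apply f x)"

lemma bidual_embedding_apply [simp]: "blinfun_apply (bidual_embedding x) f = blinfun_apply f x"
  unfolding bidual_embedding_def
  by (subst bounded_linear_Blinfun_apply) (auto intro: bounded_linear_intros)

definition reflexive_space :: "'a::banach itself \<Rightarrow> bool" where
  "reflexive_space _ \<longleftrightarrow> surj (bidual_embedding :: 'a \<Rightarrow> ('a \<Rightarrow>\<^sub>L real) \<Rightarrow>\<^sub>L real)"

text \<open>Nets decreasing to \<open>0\<close> are rendered as downward directed sets with infimum \<open>0\<close>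
  (such a set is a net indexed by itself, and the range of a decreasing net is such a set);
  the last line is convergence of the norms to \<open>0\<close> along that net.\<close>

definition order_continuous_norm :: "'a::banach_lattice itself \<Rightarrow> bool" where
  "order_continuous_norm _ \<longleftrightarrow>
    (\<forall>D :: 'a set.
      D \<noteq> {} \<and> (\<forall>x\<in>D. \<forall>y\<in>D. \<exists>z\<in>D. z \<le> x \<and> z \<le> y) \<and>
      (\<forall>x\<in>D. 0 \<le> x) \<and> (\<forall>l. (\<forall>x\<in>D. l \<le> x) \<longrightarrow> l \<le> 0)
      \<longrightarrow> (\<forall>\<epsilon>>0. \<exists>x\<in>D. \<forall>y\<in>D. y \<le> x \<longrightarrow> norm y < \<epsilon>))"

definition schauder_basis :: "(nat \<Rightarrow> 'a::banach) \<Rightarrow> bool" where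
  "schauder_basis x \<longleftrightarrow> (\<forall>v. \<exists>!a :: nat \<Rightarrow> real. (\<lambda>n. a n *\<^sub>R x n) sums v)"

definition order_given_by_basis :: "'a::banach_lattice itself \<Rightarrow> bool" where
  "order_given_by_basis _ \<longleftrightarrow>
    (\<exists>x :: nat \<Rightarrow> 'a. schauder_basis x \<and>
      (\<forall>a b :: nat \<Rightarrow> real.
        summable (\<lambda>n. a n *\<^sub>R x n) \<and> summable (\<lambda>n. b n *\<^sub>R x n) \<longrightarrow>
        ((\<Sum>n. a n *\<^sub>R x n) \<le> (\<Sum>n. b n *\<^sub>R x n) \<longleftrightarrow> (\<forall>n. a n \<le> b n))))"

section \<open>Operators\<close>

text \<open>Operators are elements of \<open>'a \<Rightarrow>\<^sub>L 'b\<close>, with its operator norm.  For positive operators,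
  hence for regular ones, boundedness is no restriction: see
  \<open>positive_linear_imp_bounded_linear\<close> below.\<close>

definition positive_operator :: "('a::banach_lattice \<Rightarrow>\<^sub>L 'b::banach_lattice) \<Rightarrow> bool" where
  "positive_operator T \<longleftrightarrow> (\<forall>x\<ge>0. 0 \<le> blinfun_apply T x)"

definition compact_operator :: "('a::banach \<Rightarrow>\<^sub>L 'b::banach) \<Rightarrow> bool" where
  "compact_operator T \<longleftrightarrow> compact (closure (blinfun_apply T ` cball 0 1))"

definition attains_norm :: "('a::banach \<Rightarrow>\<^sub>L 'b::banach) \<Rightarrow> bool" where
  "attains_norm T \<longleftrightarrow> (\<exists>x. norm x \<le> 1 \<and> norm (blinfun_apply T x) = norm T)"

definition regular_operators :: "('a::banach_lattice \<Rightarrow>\<^sub>L 'b::banach_lattice) set" where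
  "regular_operators = {P - Q | P Q. positive_operator P \<and> positive_operator Q}"

text \<open>The modulus is the supremum of \<open>T\<close> and \<open>- T\<close> in the ordered space of regular operators,
  where \<open>S \<le> T\<close> means that \<open>T - S\<close> is positive.  It exists for regular \<open>T\<close> when
  the codomain is Dedekind complete.\<close>

definition operator_modulus ::
    "('a::banach_lattice \<Rightarrow>\<^sub>L 'b::banach_lattice) \<Rightarrow> 'a \<Rightarrow>\<^sub>L 'b" where
  "operator_modulus T = (THE M. M \<in> regular_operators \<and>
     positive_operator (M - T) \<and> positive_operator (M - (- T)) \<and>
     (\<forall>U\<in>regular_operators. positive_operator (U - T) \<and> positive_operator (U - (- T))
        \<longrightarrow> positive_operator (U - M)))"

definition positive_compact_unit_ball :: "('a::banach_lattice \<Rightarrow>\<^sub>L 'b::banach_lattice) set" where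
  "positive_compact_unit_ball = {T. positive_operator T \<and> compact_operator T \<and> norm T \<le> 1}"

section \<open>The absolute strong operator topology\<close>

definition abs_SOT_nbhd ::
    "('a::banach_lattice \<Rightarrow>\<^sub>L 'b::banach_lattice) \<Rightarrow> 'a set \<Rightarrow> real \<Rightarrow> ('a \<Rightarrow>\<^sub>L 'b) set" where
  "abs_SOT_nbhd T A \<epsilon> = {S \<in> regular_operators.
     \<forall>x\<in>A. norm (blinfun_apply (operator_modulus (T - S)) x) < \<epsilon>}"

definition abs_SOT_open :: "('a::banach_lattice \<Rightarrow>\<^sub>L 'b::banach_lattice) set \<Rightarrow> bool" where
  "abs_SOT_open U \<longleftrightarrow> U \<subseteq> regular_operators \<and>
     (\<forall>T\<in>U. \<exists>A \<epsilon>. finite A \<and> A \<subseteq> {x. 0 \<le> x} \<and> 0 < \<epsilon> \<and> abs_SOT_nbhd T A \<epsilon> \<subseteq> U)"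

lemma istopology_abs_SOT_open: "istopology abs_SOT_open"
  unfolding istopology_def
proof (intro conjI allI impI)
  fix U V :: "('a \<Rightarrow>\<^sub>L 'b) set"
  assume U: "abs_SOT_open U" and V: "abs_SOT_open V"
  show "abs_SOT_open (U \<inter> V)"
    unfolding abs_SOT_open_def
  proof (intro conjI ballI)
    show "U \<inter> V \<subseteq> regular_operators"
      using U by (auto simp: abs_SOT_open_def)
  next
    fix T assume T: "T \<in> U \<inter> V"
    obtain A \<epsilon> where A: "finite A" "A \<subseteq> {x. 0 \<le> x}" "0 < \<epsilon>" "abs_SOT_nbhd T A \<epsilon> \<subseteq> U"
      using U T unfolding abs_SOT_open_def by blast
    obtain B \<delta> where B: "finite B" "B \<subseteq> {x. 0 \<le> x}" "0 < \<delta>" "abs_SOT_nbhd T B \<delta> \<subseteq> V"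
      using V T unfolding abs_SOT_open_def by blast
    have "abs_SOT_nbhd T (A \<union> B) (min \<epsilon> \<delta>) \<subseteq> abs_SOT_nbhd T A \<epsilon> \<inter> abs_SOT_nbhd T B \<delta>"
      by (auto simp: abs_SOT_nbhd_def)
    then show "\<exists>A \<epsilon>. finite A \<and> A \<subseteq> {x. 0 \<le> x} \<and> 0 < \<epsilon> \<and> abs_SOT_nbhd T A \<epsilon> \<subseteq> U \<inter> V"
      using A B by (intro exI[of _ "A \<union> B"] exI[of _ "min \<epsilon> \<delta>"]) auto
  qed
next
  fix K :: "('a \<Rightarrow>\<^sub>L 'b) set set"
  assume K: "\<forall>U\<in>K. abs_SOT_open U"
  show "abs_SOT_open (\<Union>K)"
    unfolding abs_SOT_open_def
  proof (intro conjI ballI)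
    show "\<Union>K \<subseteq> regular_operators"
      using K by (auto simp: abs_SOT_open_def)
  next
    fix T assume "T \<in> \<Union>K"
    then obtain U where U: "U \<in> K" "T \<in> U" by blast
    have "abs_SOT_open U" using K U(1) by blast
    then obtain A \<epsilon> where
      A: "finite A \<and> A \<subseteq> {x. 0 \<le> x} \<and> 0 < \<epsilon> \<and> abs_SOT_nbhd T A \<epsilon> \<subseteq> U"
      unfolding abs_SOT_open_def using U(2) by meson
    have "U \<subseteq> \<Union>K" using U(1) by (rule Union_upper)
    then show "\<exists>A \<epsilon>. finite A \<and> A \<subseteq> {x. 0 \<le> x} \<and> 0 < \<epsilon> \<and> abs_SOT_nbhd T A \<epsilon> \<subseteq> \<Union>K"
      using A by (intro exI[of _ A] exI[of _ \<epsilon>]) auto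
  qed
qed

definition abs_SOT :: "('a::banach_lattice \<Rightarrow>\<^sub>L 'b::banach_lattice) topology" where
  "abs_SOT = topology abs_SOT_open"

lemma openin_abs_SOT: "openin abs_SOT U \<longleftrightarrow> abs_SOT_open U"
  unfolding abs_SOT_def by (simp add: istopology_abs_SOT_open topology_inverse')

lemma topspace_abs_SOT: "topspace abs_SOT = regular_operators"
proof -
  have "abs_SOT_open (regular_operators :: ('a \<Rightarrow>\<^sub>L 'b) set)"
    unfolding abs_SOT_open_def
    by (auto simp: abs_SOT_nbhd_def intro!: exI[of _ "{}"] exI[of _ "1::real"])
  then show ?thesis
    unfolding topspace_def openin_abs_SOT by (auto simp: abs_SOT_open_def)
qed

definition sequentially_closedin :: "'a topology \<Rightarrow> 'a set \<Rightarrow> bool" where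
  "sequentially_closedin X S \<longleftrightarrow> S \<subseteq> topspace X \<and>
     (\<forall>\<sigma> l. (\<forall>n. \<sigma> n \<in> S) \<and> limitin X \<sigma> l sequentially \<longrightarrow> l \<in> S)"

section \<open>Automatic continuity\<close>

lemma nonneg_closed:
  fixes s :: "'a::banach_lattice"
  assumes "X \<longlonglongrightarrow> s" and "\<And>n::nat. 0 \<le> X n"
  shows "0 \<le> s"
proof -
  have "norm (sup (- s) 0) \<le> norm (X n - s)" for n
  proof (rule norm_mono_abs)
    have "- s \<le> X n - s" using assms(2)[of n] by simp
    then have "- s \<le> \<bar>X n - s\<bar>" using abs_ge_self order_trans by blast
    then have "sup (- s) 0 \<le> \<bar>X n - s\<bar>" by simp
    moreover have "0 \<le> sup (- s) 0" by simp
    ultimately show "\<bar>sup (- s) 0\<bar> \<le> \<bar>X n - s\<bar>" by simp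
  qed
  moreover have "(\<lambda>n. norm (X n - s)) \<longlonglongrightarrow> 0"
    using assms(1) by (simp add: LIM_zero tendsto_norm_zero)
  ultimately have "norm (sup (- s) 0) \<le> 0"
    by (intro LIMSEQ_le_const) auto
  then have "sup (- s) 0 = 0" by simp
  then have "- s \<le> 0" by (metis sup.cobounded1)
  then show ?thesis by simp
qed

lemma positive_linear_imp_bounded_linear:
  fixes T :: "'a::banach_lattice \<Rightarrow> 'b::banach_lattice"
  assumes lin: "linear T" and pos: "\<And>x. 0 \<le> x \<Longrightarrow> 0 \<le> T x"
  shows "bounded_linear T"
proof -
  have "\<exists>K. \<forall>x\<ge>0. norm (T x) \<le> K * norm x"
  proof (rule ccontr)
    assume "\<not> ?thesis"
    then have "\<forall>n::nat. \<exists>x\<ge>0. norm (T x) > 4 ^ n * norm x"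
      by (metis not_le)
    then obtain x where x: "\<And>n::nat. 0 \<le> x n" "\<And>n. norm (T (x n)) > 4 ^ n * norm (x n)"
      by metis
    have nz: "norm (x n) > 0" for n
      using x(2)[of n] linear_0[OF lin] by auto
    define z where "z n = (1 / (2 ^ n * norm (x n))) *\<^sub>R x n" for n
    have z0: "0 \<le> z n" for n
      unfolding z_def using x(1) by (intro scaleR_nonneg_nonneg) auto
    have nzz: "norm (z n) = (1 / 2) ^ n" for n
      using nz[of n] by (simp add: z_def power_divide)
    have Tz: "norm (T (z n)) > 2 ^ n" for n
    proof -
      have "norm (T (z n)) = (1 / (2 ^ n * norm (x n))) * norm (T (x n))"
        using nz[of n] by (simp add: z_def linear_scale[OF lin])
      also have "\<dots> > (1 / (2 ^ n * norm (x n))) * (4 ^ n * norm (x n))"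
        using nz[of n] x(2)[of n] by (intro mult_strict_left_mono) auto
      also have "(1 / (2 ^ n * norm (x n))) * (4 ^ n * norm (x n)) = (4 / 2) ^ n"
        using nz[of n] unfolding power_divide by (simp del: power_divide)
      finally show ?thesis by simp
    qed
    have "summable (\<lambda>n. norm (z n))"
      unfolding nzz by (intro summable_geometric) simp
    then have sumz: "summable z" by (rule summable_norm_cancel)
    have "2 ^ n \<le> norm (T (suminf z))" for n
    proof -
      have "(\<lambda>k. (\<Sum>i<k. z i) - z n) \<longlonglongrightarrow> suminf z - z n"
        using summable_LIMSEQ[OF sumz] by (intro tendsto_diff) auto
      then have lim: "(\<lambda>k. (\<Sum>i<k + Suc n. z i) - z n) \<longlonglongrightarrow> suminf z - z n"
        by (rule LIMSEQ_ignore_initial_segment)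
      have "0 \<le> (\<Sum>i<k + Suc n. z i) - z n" for k
      proof -
        have "z n \<le> (\<Sum>i<k + Suc n. z i)"
          using sum_mono2[of "{..<k + Suc n}" "{n}" z] z0 by simp
        then show ?thesis by simp
      qed
      then have "0 \<le> suminf z - z n" by (rule nonneg_closed[OF lim])
      then have "0 \<le> T (suminf z - z n)" by (rule pos)
      then have "T (z n) \<le> T (suminf z)" using linear_diff[OF lin, of "suminf z" "z n"] by simp
      moreover have "0 \<le> T (z n)" using z0 pos by simp
      ultimately have "\<bar>T (z n)\<bar> \<le> \<bar>T (suminf z)\<bar>" by simp
      then have "norm (T (z n)) \<le> norm (T (suminf z))" by (rule norm_mono_abs)
      with Tz[of n] show ?thesis by simp
    qed
    moreover obtain n where "norm (T (suminf z)) < 2 ^ n"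
      using real_arch_pow[of 2 "norm (T (suminf z))"] by auto
    ultimately show False by (meson not_le)
  qed
  then obtain K where K: "\<And>x. 0 \<le> x \<Longrightarrow> norm (T x) \<le> K * norm x" by blast
  have K': "norm (T x) \<le> max K 0 * norm x" if "0 \<le> x" for x
    using K[OF that] mult_right_mono[of K "max K 0" "norm x"] by simp
  have "norm (T x) \<le> norm x * (2 * max K 0)" for x
  proof -
    let ?p = "sup x 0" and ?q = "sup x 0 - x"
    have q0: "0 \<le> ?q" by simp
    have p: "norm ?p \<le> norm x"
    proof (rule norm_mono_abs)
      have "?p \<le> \<bar>x\<bar>" by (simp add: abs_ge_self)
      then show "\<bar>?p\<bar> \<le> \<bar>x\<bar>" by simp
    qed
    have q: "norm ?q \<le> norm x"
    proof (rule norm_mono_abs)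
      have "x \<le> x + \<bar>x\<bar>" by simp
      moreover have "0 \<le> x + \<bar>x\<bar>"
        using add_left_mono[OF abs_ge_minus_self[of x], of x] by simp
      ultimately have "?q \<le> \<bar>x\<bar>" by (simp add: diff_le_eq add.commute)
      then show "\<bar>?q\<bar> \<le> \<bar>x\<bar>" using q0 by simp
    qed
    have "T x = T ?p - T ?q" using linear_diff[OF lin, of ?p ?q] by simp
    then have "norm (T x) \<le> norm (T ?p) + norm (T ?q)" by (simp add: norm_triangle_ineq4)
    also have "\<dots> \<le> max K 0 * norm ?p + max K 0 * norm ?q"
      using K'[of ?p] K'[OF q0] by (intro add_mono) auto
    also have "\<dots> \<le> max K 0 * norm x + max K 0 * norm x"
      using p q by (intro add_mono mult_left_mono) auto
    finally show ?thesis by (simp add: algebra_simps)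
  qed
  then show ?thesis
    by (intro bounded_linear_intro[of T "2 * max K 0"]) (auto simp: linear_add[OF lin] linear_scale[OF lin])
qed

end

theory Submission
  imports Defs
begin

text \<open>Compact operators on a reflexive space attain their norms because the unit ball is weakly compact:
  a maximizing sequence has a weak cluster point, and its images converge in norm
  (\<open>reflexive_compact_operator_attains_norm\<close>).  The functionals needed come from the Hahn-Banach theorem, proved
  by minimizing sublinear functionals.

  The step from norm attainment to closedness rests on Simons' inequality
  (\<open>convex_combinations_approach_zero\<close>).  Suppose that positive compact operators \<open>\<sigma> n\<close> converge to \<open>T\<close>
  in the absolute strong operator topology.  Pointwise, \<open>|T - \<sigma> n|\<close> tends to zero on the positive cone.  Norm
  attainment makes pairs of a positive vector and a functional on the codomain a boundary for the
  closed convex hull of these moduli, and Simons' inequality upgrades pointwise convergence on a boundary to norm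
  convergence of convex combinations.  Since \<open>|T - K|\<close> is dominated by such a combination for a suitable convex combination
  \<open>K\<close> of the \<open>\<sigma> n\<close>, the operator \<open>T\<close> is a norm limit of compact operators
  (\<open>compact_unit_ball_sequentially_closed\<close>).  That the moduli exist is the Riesz-Kantorovich theorem
  (\<open>is_modulus_operator_modulus\<close>).

  If the order of a space is given by a basis, the basis projections \<open>P n\<close> are positive, lie below the identity, have finite
  rank and converge strongly to the identity (\<open>order_basis_projections\<close>).  Composing a positive \<open>T\<close> with them, on
  the side where the basis is available, gives compact operators between \<open>0\<close> and \<open>T\<close> that
  converge to \<open>T\<close> in the absolute strong operator topology, so closedness makes \<open>T\<close> compact.\<close>

section \<open>The Hahn-Banach theorem\<close>

text \<open>Positive homogeneity is demanded only as an inequality for scalars \<open>c \<ge> 0\<close>.  This is the easier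
  form to check for infima of functionals; \<open>c = 0\<close> gives \<open>p 0 \<le> 0\<close>, and applying the
  inequality to \<open>1 / c\<close> gives the reverse inequality for \<open>c > 0\<close>.\<close>

definition sublinear :: "('a::real_vector \<Rightarrow> real) \<Rightarrow> bool" where
  "sublinear p \<longleftrightarrow> (\<forall>x y. p (x + y) \<le> p x + p y) \<and> (\<forall>c\<ge>0. \<forall>x. p (c *\<^sub>R x) \<le> c * p x)"

lemma sublinear_scaleR:
  assumes "sublinear p" "0 < c"
  shows "p (c *\<^sub>R x) = c * p x"
proof (rule antisym)
  show "p (c *\<^sub>R x) \<le> c * p x" using assms by (simp add: sublinear_def)
  have "p ((1 / c) *\<^sub>R (c *\<^sub>R x)) \<le> (1 / c) * p (c *\<^sub>R x)"
    using assms unfolding sublinear_def by (meson less_imp_le zero_less_divide_1_iff)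
  then show "c * p x \<le> p (c *\<^sub>R x)" using \<open>0 < c\<close> by (simp add: field_simps)
qed

lemma sublinear_zero:
  assumes "sublinear p"
  shows "p 0 = 0"
proof -
  have "p (0 + 0) \<le> p 0 + p 0" using assms unfolding sublinear_def by blast
  moreover have "p (0 *\<^sub>R 0) \<le> 0 * p 0" using assms unfolding sublinear_def by blast
  ultimately show ?thesis by simp
qed

lemma sublinear_ge_neg: "sublinear p \<Longrightarrow> - p (- x) \<le> p x"
  using sublinear_zero[of p] unfolding sublinear_def by (smt (verit) add.right_inverse)

text \<open>The functional \<open>q\<close> is the lower envelope of the translates \<open>p (y + t x) - t p x\<close> over \<open>t \<ge> 0\<close>.
  If \<open>p\<close> is minimal, then \<open>q = p\<close>, and the bound at \<open>- x\<close> becomes \<open>p (- x) = - p x\<close>;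
  so nonlinearity in any direction can be removed by tightening.  When \<open>p\<close> is the norm, the same
  bound forces every linear minorant of \<open>q\<close> to norm \<open>x\<close>.\<close>

lemma sublinear_tighten:
  assumes p: "sublinear p"
  obtains q where "sublinear q" "\<And>y. q y \<le> p y" "q (- x) \<le> - p x"
proof -
  define q where "q y = (INF t\<in>{0..}. p (y + t *\<^sub>R x) - t * p x)" for y
  have sub: "p (u + v) \<le> p u + p v" for u v using p by (simp add: sublinear_def)
  have tx: "p (t *\<^sub>R x) = t * p x" if "0 \<le> t" for t
    using that sublinear_scaleR[OF p, of t x] sublinear_zero[OF p] by (cases "t = 0") auto
  have bdd: "bdd_below ((\<lambda>t. p (y + t *\<^sub>R x) - t * p x) ` {0..})" for y
  proof (intro bdd_belowI2)
    fix t :: real assume "t \<in> {0..}"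
    then show "- p (- y) \<le> p (y + t *\<^sub>R x) - t * p x"
      using sub[of "y + t *\<^sub>R x" "- y"] tx[of t] by simp
  qed
  have upper: "q y \<le> p (y + t *\<^sub>R x) - t * p x" if "0 \<le> t" for y t
    unfolding q_def using bdd that by (intro cINF_lower) auto
  have lower: "b \<le> q y" if "\<And>t. 0 \<le> t \<Longrightarrow> b \<le> p (y + t *\<^sub>R x) - t * p x" for y b
    unfolding q_def using that by (intro cINF_greatest) auto
  show ?thesis
  proof
    show "q y \<le> p y" for y using upper[of 0 y] by simp
    show "q (- x) \<le> - p x" using upper[of 1 "- x"] sublinear_zero[OF p] by simp
    show "sublinear q"
      unfolding sublinear_def
    proof (intro conjI allI impI)
      fix y z
      have "q (y + z) - (p (z + t *\<^sub>R x) - t * p x) \<le> q y" if t: "0 \<le> t" for t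
      proof (rule lower)
        fix s :: real assume s: "0 \<le> s"
        have "p (y + z + (s + t) *\<^sub>R x) \<le> p (y + s *\<^sub>R x) + p (z + t *\<^sub>R x)"
          using sub[of "y + s *\<^sub>R x" "z + t *\<^sub>R x"] by (simp add: algebra_simps)
        then show "q (y + z) - (p (z + t *\<^sub>R x) - t * p x) \<le> p (y + s *\<^sub>R x) - s * p x"
          using upper[of "s + t" "y + z"] s t by (simp add: algebra_simps)
      qed
      then have "q (y + z) - q y \<le> q z" by (intro lower) (smt (verit))
      then show "q (y + z) \<le> q y + q z" by simp
    next
      fix c :: real and y assume c: "0 \<le> c"
      show "q (c *\<^sub>R y) \<le> c * q y"
      proof (cases "c = 0")
        case True then show ?thesis using upper[of 0 0] sublinear_zero[OF p] by simp
      next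
        case False
        with c have c: "0 < c" by simp
        have "q (c *\<^sub>R y) / c \<le> q y"
        proof (rule lower)
          fix t :: real assume t: "0 \<le> t"
          have "q (c *\<^sub>R y) \<le> p (c *\<^sub>R (y + t *\<^sub>R x)) - c * t * p x"
            using upper[of "c * t" "c *\<^sub>R y"] c t by (simp add: algebra_simps)
          also have "\<dots> = c * (p (y + t *\<^sub>R x) - t * p x)"
            using sublinear_scaleR[OF p c, of "y + t *\<^sub>R x"] by (simp add: algebra_simps)
          finally show "q (c *\<^sub>R y) / c \<le> p (y + t *\<^sub>R x) - t * p x"
            using c by (simp add: field_simps)
        qed
        then show ?thesis using c by (simp add: field_simps)
      qed
    qed
  qed
qed

text \<open>The pointwise infimum of a chain.  Subadditivity survives because two members \<open>q\<close>, \<open>r\<close>, evaluated at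
  different points, can both be replaced by the smaller of them.\<close>

lemma sublinear_chain_lower_bound:
  assumes C: "C \<noteq> {}" "\<And>q. q \<in> C \<Longrightarrow> sublinear q"
    and chain: "\<And>q r. q \<in> C \<Longrightarrow> r \<in> C \<Longrightarrow> q \<le> r \<or> r \<le> q"
    and bdd: "\<And>q. q \<in> C \<Longrightarrow> q \<le> p"
  obtains u where "sublinear u" "\<And>q. q \<in> C \<Longrightarrow> u \<le> q"
proof -
  define u where "u x = (INF q\<in>C. q x)" for x
  have "bdd_below ((\<lambda>q. q x) ` C)" for x
  proof (intro bdd_belowI2)
    fix q assume q: "q \<in> C"
    have "q (- x) \<le> p (- x)" using bdd[OF q] by (simp add: le_fun_def)
    then show "- p (- x) \<le> q x" using sublinear_ge_neg[OF C(2)[OF q], of x] by linarith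
  qed
  then have upper: "u x \<le> q x" if "q \<in> C" for q x
    unfolding u_def using that by (intro cINF_lower)
  have lower: "b \<le> u x" if "\<And>q. q \<in> C \<Longrightarrow> b \<le> q x" for x b
    unfolding u_def using that C(1) by (intro cINF_greatest)
  have "sublinear u"
    unfolding sublinear_def
  proof (intro conjI allI impI)
    fix x y
    have "u (x + y) - r y \<le> u x" if r: "r \<in> C" for r
    proof (rule lower)
      fix q assume q: "q \<in> C"
      obtain s where s: "s \<in> C" "s \<le> q" "s \<le> r" using chain[OF q r] q r by blast
      have "s (x + y) \<le> s x + s y" using C(2)[OF s(1)] by (simp add: sublinear_def)
      then show "u (x + y) - r y \<le> q x"
        using upper[OF s(1), of "x + y"] le_funD[OF s(2), of x] le_funD[OF s(3), of y] by simp
    qed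
    then have "u (x + y) - u x \<le> u y" by (intro lower) (smt (verit))
    then show "u (x + y) \<le> u x + u y" by simp
  next
    fix c :: real and x assume c: "0 \<le> c"
    show "u (c *\<^sub>R x) \<le> c * u x"
    proof (cases "c = 0")
      case True
      then show ?thesis using C upper sublinear_zero
        by (metis ex_in_conv mult_zero_left scaleR_zero_left)
    next
      case False
      with c have c: "0 < c" by simp
      have "u (c *\<^sub>R x) / c \<le> u x"
        using upper sublinear_scaleR[OF C(2) c]
        by (intro lower) (metis c mult.commute pos_divide_le_eq)
      then show ?thesis using c by (simp add: field_simps)
    qed
  qed
  then show ?thesis using that upper by (auto simp: le_fun_def)
qed

text \<open>Hahn-Banach, by way of a minimal sublinear functional: minimality and
  \<open>sublinear_tighten\<close> make it odd, and an odd subadditive functional is additive.\<close>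

theorem sublinear_dominates_linear:
  assumes p: "sublinear p"
  obtains f where "linear f" "\<And>x. f x \<le> p x"
proof -
  define A where "A = {q. sublinear q \<and> q \<le> p}"
  have "\<exists>m\<in>A. \<forall>a\<in>A. a \<le> m \<longrightarrow> a = m"
  proof (rule predicate_Zorn)
    show "partial_order_on A (relation_of (\<lambda>q r. r \<le> q) A)"
      by (rule partial_order_on_relation_ofI) auto
    fix C assume C: "C \<in> Chains (relation_of (\<lambda>q r. r \<le> q) A)"
    then have CA: "\<And>q. q \<in> C \<Longrightarrow> q \<in> A"
      and ch: "\<And>q r. q \<in> C \<Longrightarrow> r \<in> C \<Longrightarrow> q \<le> r \<or> r \<le> q"
      by (auto simp: Chains_def relation_of_def)
    show "\<exists>u\<in>A. \<forall>a\<in>C. u \<le> a"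
    proof (cases "C = {}")
      case True then show ?thesis using p by (auto simp: A_def)
    next
      case False
      then obtain q where q: "q \<in> C" by blast
      obtain u where "sublinear u" "\<And>q. q \<in> C \<Longrightarrow> u \<le> q"
        using sublinear_chain_lower_bound[OF False, of p] CA ch unfolding A_def by blast
      moreover from this(2)[OF q] have "u \<le> p"
        using CA[OF q] unfolding A_def by (auto intro: order_trans)
      ultimately show ?thesis unfolding A_def by blast
    qed
  qed
  then obtain m where m: "sublinear m" "m \<le> p"
    and min: "\<And>q. sublinear q \<Longrightarrow> q \<le> p \<Longrightarrow> q \<le> m \<Longrightarrow> q = m"
    unfolding A_def by blast
  have neg: "m (- x) = - m x" for x
  proof -
    obtain q where q: "sublinear q" "\<And>y. q y \<le> m y" "q (- x) \<le> - m x"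
      using sublinear_tighten[OF m(1)] by blast
    have "q \<le> m" using q(2) by (simp add: le_fun_def)
    then have "q = m" using min[OF q(1) order_trans[OF _ m(2)]] by blast
    then have "m (- x) \<le> - m x" using q(3) by simp
    then show ?thesis using sublinear_ge_neg[OF m(1), of x] by linarith
  qed
  have sub: "m (x + y) \<le> m x + m y" for x y using m(1) by (simp add: sublinear_def)
  have add: "m (x + y) = m x + m y" for x y
    using sub[of x y] sub[of "x + y" "- y"] neg[of y] by simp
  have "linear m"
  proof (rule linearI)
    show "m (x + y) = m x + m y" for x y by (rule add)
    show "m (c *\<^sub>R x) = c *\<^sub>R m x" for c x
    proof (cases c "0::real" rule: linorder_cases)
      case less
      then show ?thesis using sublinear_scaleR[OF m(1), of "- c" x] neg[of "c *\<^sub>R x"] by simp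
    next
      case equal then show ?thesis using sublinear_zero[OF m(1)] by simp
    next
      case greater then show ?thesis using sublinear_scaleR[OF m(1)] by simp
    qed
  qed
  then show ?thesis using that m(2) by (auto simp: le_fun_def)
qed

theorem norming_functional:
  fixes y :: "'a::real_normed_vector"
  obtains g :: "'a \<Rightarrow>\<^sub>L real" where "norm g \<le> 1" "blinfun_apply g y = norm y"
proof -
  have "sublinear (norm :: 'a \<Rightarrow> real)"
    by (simp add: sublinear_def norm_triangle_ineq)
  then obtain q where q: "sublinear q" "\<And>x. q x \<le> norm x" "q (- y) \<le> - norm y"
    using sublinear_tighten by blast
  then obtain f where f: "linear f" "\<And>x. f x \<le> q x"
    using sublinear_dominates_linear by blast
  have le: "f x \<le> norm x" for x using f(2) q(2) order_trans by blast
  have abs: "\<bar>f x\<bar> \<le> norm x" for x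
    using le[of x] le[of "- x"] linear_neg[OF f(1), of x] by auto
  have "bounded_linear f"
    using f(1) abs by (intro bounded_linear_intro[of f 1]) (auto simp: linear_add linear_scale)
  then have app: "blinfun_apply (Blinfun f) = f" by (rule bounded_linear_Blinfun_apply)
  show ?thesis
  proof
    show "norm (Blinfun f) \<le> 1" using abs by (intro norm_blinfun_bound) (auto simp: app)
    show "blinfun_apply (Blinfun f) y = norm y"
      unfolding app using le[of y] f(2)[of "- y"] q(3) linear_neg[OF f(1), of y] by simp
  qed
qed

section \<open>Norm attainment on reflexive spaces\<close>

text \<open>A sequential form of weak compactness of the unit ball.  The evaluations \<open>f \<mapsto> f (x n)\<close> lie in the
  product of the intervals \<open>[- norm f, norm f]\<close>, which is compact by Tychonoff.  A cluster point of
  them is linear and bounded by \<open>1\<close>, hence an element of the bidual, hence evaluation at some \<open>z\<close>.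
  Only functionals that already converge along the sequence need to be controlled, so no
  subsequence is extracted.\<close>

lemma reflexive_bounded_sequence_cluster:
  fixes x :: "nat \<Rightarrow> 'a::banach"
  assumes refl: "reflexive_space TYPE('a)" and x: "\<And>n. norm (x n) \<le> 1"
  obtains z where "norm z \<le> 1"
    "\<And>(f :: 'a \<Rightarrow>\<^sub>L real) l. (\<lambda>n. blinfun_apply f (x n)) \<longlonglongrightarrow> l \<Longrightarrow> blinfun_apply f z = l"
proof -
  define K :: "(('a \<Rightarrow>\<^sub>L real) \<Rightarrow> real) set" where "K = PiE UNIV (\<lambda>f. cball 0 (norm f))"
  define e where "e n = (\<lambda>f::'a \<Rightarrow>\<^sub>L real. blinfun_apply f (x n))" for n
  have "compactin (product_topology (\<lambda>f. euclidean) UNIV) K"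
    unfolding K_def compactin_PiE by (simp add: compactin_euclidean_iff)
  then have cK: "compact K" by (simp add: euclidean_product_topology compactin_euclidean_iff)
  have eb: "\<bar>e n f\<bar> \<le> norm f" for n f
    using norm_blinfun[of f "x n"] mult_left_mono[OF x[of n] norm_ge_zero[of f]]
    by (simp add: e_def)
  then have "eventually (\<lambda>\<phi>. \<phi> \<in> K) (filtermap e sequentially)"
    by (auto simp: eventually_filtermap K_def PiE_iff dist_norm)
  moreover have "filtermap e sequentially \<noteq> bot" by (simp add: filtermap_bot_iff)
  ultimately obtain \<phi> where \<phi>: "\<phi> \<in> K" "inf (nhds \<phi>) (filtermap e sequentially) \<noteq> bot"
    using cK unfolding compact_filter by blast
  \<comment> \<open>Pulling the neighbourhoods of the cluster point back to the indices gives a filter finer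
    than \<open>sequentially\<close>, along which every \<open>f (x n)\<close> converges; limits along it inherit linearity.\<close>
  define G where "G = inf (filtercomap e (nhds \<phi>)) sequentially"
  have Gnb: "G \<noteq> bot"
  proof
    assume "G = bot"
    then have "eventually (\<lambda>n. False) G" by simp
    then obtain P Q where PQ: "eventually P (filtercomap e (nhds \<phi>))" "eventually Q sequentially"
      "\<And>n. P n \<Longrightarrow> Q n \<Longrightarrow> False" unfolding G_def eventually_inf by blast
    then obtain R where R: "eventually R (nhds \<phi>)" "\<And>n. R (e n) \<Longrightarrow> P n"
      unfolding eventually_filtercomap by blast
    have "eventually (\<lambda>\<psi>. \<not> R \<psi>) (filtermap e sequentially)"
      unfolding eventually_filtermap using PQ(2) by eventually_elim (use R PQ in blast)
    then have "eventually (\<lambda>_. False) (inf (nhds \<phi>) (filtermap e sequentially))"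
      unfolding eventually_inf using R(1) by blast
    then show False using \<phi>(2) by (simp add: trivial_limit_def)
  qed
  have eG: "filterlim e (nhds \<phi>) G" unfolding G_def
    by (meson filterlim_filtercomap filterlim_mono inf_le1 order_refl)
  have lim: "((\<lambda>n. blinfun_apply f (x n)) \<longlongrightarrow> \<phi> f) G" for f
  proof -
    have "((\<lambda>\<psi>. \<psi> f) \<longlongrightarrow> \<phi> f) (nhds \<phi>)"
    proof (rule topological_tendstoI)
      fix S :: "real set" assume S: "open S" "\<phi> f \<in> S"
      have "open ((\<lambda>\<psi>::('a \<Rightarrow>\<^sub>L real) \<Rightarrow> real. \<psi> f) -` S)"
        using S(1) by (intro open_vimage continuous_on_product_coordinates)
      then show "eventually (\<lambda>\<psi>. \<psi> f \<in> S) (nhds \<phi>)"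
        using S(2) unfolding eventually_nhds by auto
    qed
    from filterlim_compose[OF this eG] show ?thesis by (simp add: e_def)
  qed
  have ble: "\<bar>\<phi> f\<bar> \<le> norm f" for f
    using \<phi>(1) by (auto simp: K_def PiE_iff dist_norm)
  have "bounded_linear \<phi>"
  proof (rule bounded_linear_intro[of _ 1])
    show "\<phi> (f + g) = \<phi> f + \<phi> g" for f g
      using tendsto_unique[OF Gnb lim[of "f + g"]] tendsto_add[OF lim[of f] lim[of g]]
      by (simp add: blinfun.add_left)
    show "\<phi> (c *\<^sub>R f) = c *\<^sub>R \<phi> f" for c f
      using tendsto_unique[OF Gnb lim[of "c *\<^sub>R f"]] tendsto_scaleR[OF tendsto_const lim[of f], of c]
      by (simp add: blinfun.scaleR_left)
    show "norm (\<phi> f) \<le> norm f * 1" for f using ble by simp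
  qed
  then have app: "blinfun_apply (Blinfun \<phi>) = \<phi>" by (rule bounded_linear_Blinfun_apply)
  obtain z where z: "bidual_embedding z = Blinfun \<phi>"
    using refl unfolding reflexive_space_def by (metis surjD)
  have zf: "blinfun_apply f z = \<phi> f" for f
    using bidual_embedding_apply[of z f] z app by simp
  show ?thesis
  proof
    obtain g :: "'a \<Rightarrow>\<^sub>L real" where g: "norm g \<le> 1" "blinfun_apply g z = norm z"
      by (rule norming_functional)
    then show "norm z \<le> 1" using ble[of g] zf[of g] by simp
    fix f :: "'a \<Rightarrow>\<^sub>L real" and l
    assume "(\<lambda>n. blinfun_apply f (x n)) \<longlonglongrightarrow> l"
    then have "((\<lambda>n. blinfun_apply f (x n)) \<longlongrightarrow> l) G"
      unfolding G_def by (rule tendsto_mono[OF inf_le2])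
    then show "blinfun_apply f z = l" using tendsto_unique[OF Gnb lim] zf by metis
  qed
qed

text \<open>Along a maximizing sequence the images converge in norm to some \<open>y\<close>, by compactness, while the
  sequence itself has a weak cluster point \<open>z\<close>.  Functionals on the codomain cannot tell \<open>T z\<close> from \<open>y\<close>,
  so \<open>norm (T z) = norm y = norm T\<close>.\<close>

lemma reflexive_compact_operator_attains_norm:
  fixes T :: "'a::banach \<Rightarrow>\<^sub>L 'b::banach"
  assumes refl: "reflexive_space TYPE('a)" and T: "compact_operator T"
  shows "attains_norm T"
proof -
  have "\<exists>x. norm x \<le> 1 \<and> norm T - inverse (real (Suc n)) \<le> norm (blinfun_apply T x)" for n
  proof (rule ccontr)
    assume "\<not> ?thesis"
    then have *: "\<And>x. norm x \<le> 1 \<Longrightarrow> norm (blinfun_apply T x) < norm T - inverse (real (Suc n))"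
      by (meson not_le)
    have "norm T \<le> norm T - inverse (real (Suc n))"
    proof (rule norm_blinfun_bound)
      show "0 \<le> norm T - inverse (real (Suc n))" using *[of 0] by simp
      fix x
      show "norm (blinfun_apply T x) \<le> (norm T - inverse (real (Suc n))) * norm x"
      proof (cases "x = 0")
        case False
        then show ?thesis
          using *[of "(1 / norm x) *\<^sub>R x"] by (simp add: blinfun.scaleR_right field_simps)
      qed simp
    qed
    then show False by simp
  qed
  then obtain x where x: "\<And>n. norm (x n) \<le> 1"
    "\<And>n. norm T - inverse (real (Suc n)) \<le> norm (blinfun_apply T (x n))" by metis
  have "blinfun_apply T (x n) \<in> closure (blinfun_apply T ` cball 0 1)" for n
    using x(1)[of n] closure_subset by fastforce
  then obtain y r where r: "strict_mono r" "(\<lambda>n. blinfun_apply T (x (r n))) \<longlonglongrightarrow> y"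
    using seq_compactE[OF compact_imp_seq_compact[OF T[unfolded compact_operator_def]],
        of "\<lambda>n. blinfun_apply T (x n)"] unfolding o_def by blast
  obtain z where z: "norm z \<le> 1"
    "\<And>(f :: 'a \<Rightarrow>\<^sub>L real) l. (\<lambda>n. blinfun_apply f (x (r n))) \<longlonglongrightarrow> l \<Longrightarrow> blinfun_apply f z = l"
    by (rule reflexive_bounded_sequence_cluster[OF refl, of "\<lambda>n. x (r n)"]) (use x(1) in auto)
  have eq: "blinfun_apply g (blinfun_apply T z) = blinfun_apply g y" for g :: "'b \<Rightarrow>\<^sub>L real"
    using z(2)[of "g o\<^sub>L T"] blinfun.tendsto[OF tendsto_const r(2), of g] by simp
  obtain g :: "'b \<Rightarrow>\<^sub>L real" where "blinfun_apply g (blinfun_apply T z - y) = norm (blinfun_apply T z - y)"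
    by (rule norming_functional)
  then have Tz: "blinfun_apply T z = y" using eq[of g] by (simp add: blinfun.diff_right)
  have "(\<lambda>n. norm T - inverse (real (Suc (r n)))) \<longlonglongrightarrow> norm T - 0"
    by (intro tendsto_diff tendsto_const LIMSEQ_subseq_LIMSEQ[OF LIMSEQ_inverse_real_of_nat r(1), unfolded o_def])
  then have "norm T - 0 \<le> norm y"
    using x(2) by (intro LIMSEQ_le[OF _ tendsto_norm[OF r(2)]]) auto
  moreover have "norm y \<le> norm T"
    using norm_blinfun[of T z] mult_left_mono[OF z(1) norm_ge_zero[of T]] Tz by simp
  ultimately show ?thesis unfolding attains_norm_def using z(1) Tz by (intro exI[of _ z]) auto
qed

section \<open>Simons' inequality\<close>

text \<open>The weights \<open>1/2, 1/4, ...\<close> sum to \<open>1\<close>, so the series is an infinite convex combination.  The leftover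
  weight of a partial sum is put on an arbitrary point of \<open>C\<close>, which keeps everything inside \<open>C\<close>.\<close>

lemma dyadic_series_in_closed_convex:
  fixes C :: "'a::real_normed_vector set"
  assumes C: "closed C" "convex C" and g: "\<And>n. g n \<in> C"
    and t: "(\<lambda>n. (1 / 2) ^ Suc n *\<^sub>R g n) sums t"
  shows "t \<in> C"
proof -
  define u where "u N c = (\<Sum>n<N. (1 / 2) ^ Suc n *\<^sub>R g n) + (1 / 2) ^ N *\<^sub>R c" for N c
  have "u N c \<in> C" if "c \<in> C" for N c
    using that
  proof (induction N arbitrary: c)
    case (Suc N)
    have "u (Suc N) c = u N ((1 / 2) *\<^sub>R g N + (1 / 2) *\<^sub>R c)"
      by (simp add: u_def algebra_simps)
    then show ?case
      using Suc.IH[of "(1 / 2) *\<^sub>R g N + (1 / 2) *\<^sub>R c"] convexD[OF C(2) g[of N] Suc.prems, of "1/2" "1/2"]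
      by simp
  qed (simp add: u_def)
  then have "u N (g 0) \<in> C" for N using g by blast
  moreover have "(\<lambda>N. u N (g 0)) \<longlonglongrightarrow> t + 0 *\<^sub>R g 0"
    using t unfolding u_def sums_def
    by (intro tendsto_add tendsto_scaleR tendsto_const LIMSEQ_realpow_zero) auto
  ultimately show ?thesis
    using C(1) unfolding closed_sequential_limits by fastforce
qed

lemma closed_convex_hull_le_functional:
  fixes \<phi> :: "'a::real_normed_vector \<Rightarrow> real"
  assumes "bounded_linear \<phi>" "\<And>x. x \<in> S \<Longrightarrow> \<phi> x \<le> b" and "x \<in> closure (convex hull S)"
  shows "\<phi> x \<le> b"
proof -
  interpret bounded_linear \<phi> by fact
  have "convex {x. \<phi> x \<le> b}"
    unfolding convex_def
    by (auto simp: add scaleR) (metis convex_bound_le)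
  then have "convex hull S \<subseteq> {x. \<phi> x \<le> b}"
    using assms(2) by (intro hull_minimal) auto
  moreover have "closed {x. \<phi> x \<le> b}"
    by (intro closed_Collect_le continuous_on_const linear_continuous_on assms(1))
  ultimately show ?thesis using closure_minimal assms(3) by blast
qed

text \<open>Simons' inequality in the case of limit zero, where it says the following: if each vector \<open>s\<close> of
  the closed convex hull is normed by a functional along which \<open>S\<close> tends to zero, then convex combinations of \<open>S\<close>
  become small in norm.

  Suppose that they all have norm at least \<open>e\<close>.  Vectors \<open>g k\<close> in the closed convex hull of the tail
  \<open>S k, S (k + 1), ...\<close> are chosen greedily: with \<open>s k\<close> the sum of the \<open>2^-(n+1) g n\<close> for \<open>n < k\<close>, the norm of
  \<open>s k + 2^-k g k\<close> is minimal up to \<open>\<epsilon> k\<close>.  Let \<open>t\<close> be the sum of the whole series and \<open>\<phi>\<close> a functional that norms \<open>t\<close>.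
  The normalized remainder \<open>r k = 2^k (t - s k)\<close> competes with \<open>g k\<close>, so
  \<open>\<phi> (s k + 2^-k g k) \<le> norm t + \<epsilon> k\<close>, and this rearranges to \<open>\<phi> (r k) \<le> \<phi> (r (k + 1)) + 2^k \<epsilon> k\<close>.
  Hence \<open>\<phi> (r k)\<close> stays above about \<open>\<phi> (r 0) = norm t \<ge> e\<close>.  But \<open>r k\<close> lies in the closed convex hull of the
  \<open>k\<close>-th tail, on which \<open>\<phi>\<close> is eventually small.\<close>

theorem convex_combinations_approach_zero:
  fixes S :: "nat \<Rightarrow> 'a::banach"
  assumes bdd: "\<And>n. norm (S n) \<le> M"
    and attain: "\<And>s. s \<in> closure (convex hull (range S)) \<Longrightarrow>
      \<exists>\<phi>. bounded_linear \<phi> \<and> (\<forall>v. \<phi> v \<le> norm v) \<and> \<phi> s = norm s \<and> (\<lambda>n. \<phi> (S n)) \<longlonglongrightarrow> 0"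
    and e: "0 < e"
  shows "\<exists>g \<in> convex hull (range S). norm g < e"
proof (rule ccontr)
  assume neg: "\<not> ?thesis"
  define C where "C n = closure (convex hull (S ` {n..}))" for n
  have C0: "C 0 = closure (convex hull (range S))" by (simp add: C_def atLeast_0)
  have clC: "closed (C n)" and cvC: "convex (C n)" for n
    by (auto simp: C_def intro: convex_closure convex_convex_hull)
  have CM: "norm g \<le> M" if "g \<in> C n" for g n
  proof -
    have "convex hull (S ` {n..}) \<subseteq> cball 0 M" using bdd by (intro hull_minimal) auto
    then have "C n \<subseteq> cball 0 M" unfolding C_def by (intro closure_minimal) auto
    then show ?thesis using that by auto
  qed
  have antiC: "C n \<subseteq> C k" if "k \<le> n" for k n
    unfolding C_def using that by (intro closure_mono hull_mono image_mono) auto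
  have nonempty: "S n \<in> C n" for n
    unfolding C_def by (meson atLeast_iff closure_subset hull_inc image_eqI order_refl subsetD)
  have far: "e \<le> norm g" if "g \<in> C 0" for g
  proof -
    have "convex hull (range S) \<subseteq> {v. e \<le> norm v}" using neg by (auto simp: not_less)
    moreover have "closed {v::'a. e \<le> norm v}"
      by (intro closed_Collect_le continuous_intros)
    ultimately show ?thesis using that closure_minimal unfolding C0 by blast
  qed
  \<comment> \<open>Chosen so that the accumulated loss, the sum of all \<open>2 ^ k * \<epsilon> k\<close>, is \<open>e / 2\<close>.\<close>
  define \<epsilon> where "\<epsilon> k = e / 4 * (1 / 4) ^ k" for k :: nat
  have \<epsilon>: "0 < \<epsilon> k" for k using e by (simp add: \<epsilon>_def)
  have "\<exists>g\<in>C k. \<forall>h\<in>C k. norm (s + (1 / 2) ^ k *\<^sub>R g) \<le> norm (s + (1 / 2) ^ k *\<^sub>R h) + \<epsilon> k" for s k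
  proof -
    let ?N = "\<lambda>g. norm (s + (1 / 2) ^ k *\<^sub>R g)"
    have bb: "bdd_below (?N ` C k)" by (intro bdd_belowI2[of _ 0]) simp
    have "Inf (?N ` C k) < Inf (?N ` C k) + \<epsilon> k" using \<epsilon>[of k] by simp
    then obtain g where g: "g \<in> C k" "?N g < Inf (?N ` C k) + \<epsilon> k"
      using nonempty[of k] bb by (subst (asm) cInf_less_iff) auto
    have "?N g \<le> ?N h + \<epsilon> k" if "h \<in> C k" for h
      using cINF_lower[OF bb that] g(2) by linarith
    then show ?thesis using g(1) by blast
  qed
  then obtain G where G: "\<And>k s. G k s \<in> C k"
    "\<And>k s h. h \<in> C k \<Longrightarrow> norm (s + (1 / 2) ^ k *\<^sub>R G k s) \<le> norm (s + (1 / 2) ^ k *\<^sub>R h) + \<epsilon> k"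
    by metis
  define s where "s = rec_nat 0 (\<lambda>k v. v + (1 / 2) ^ Suc k *\<^sub>R G k v)"
  define g where "g k = G k (s k)" for k
  have s0: "s 0 = 0" and sSuc: "s (Suc k) = s k + (1 / 2) ^ Suc k *\<^sub>R g k" for k
    by (simp_all add: s_def g_def)
  have s_sum: "s k = (\<Sum>n<k. (1 / 2) ^ Suc n *\<^sub>R g n)" for k
    by (induction k) (simp_all add: s0 sSuc)
  have summ: "summable (\<lambda>n. (1 / 2) ^ Suc n *\<^sub>R g n)"
  proof (rule summable_norm_cancel, rule summable_comparison_test')
    have "summable (\<lambda>n. (1 / 2 :: real) ^ Suc n)"
      unfolding summable_Suc_iff by (intro summable_geometric) simp
    then show "summable (\<lambda>n. (1 / 2) ^ Suc n * M)" by (rule summable_mult2)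
    fix n
    have "norm (g n) \<le> M" using CM G(1) unfolding g_def by blast
    then have "(1 / 2) ^ Suc n * norm (g n) \<le> (1 / 2) ^ Suc n * M" by (intro mult_left_mono) auto
    then show "norm (norm ((1 / 2) ^ Suc n *\<^sub>R g n)) \<le> (1 / 2) ^ Suc n * M" by simp
  qed
  define t where "t = suminf (\<lambda>n. (1 / 2) ^ Suc n *\<^sub>R g n)"
  define r where "r k = 2 ^ k *\<^sub>R (t - s k)" for k
  have rC: "r k \<in> C k" for k
  proof (rule dyadic_series_in_closed_convex[OF clC cvC])
    show "g (n + k) \<in> C k" for n using G(1) antiC[of k "n + k"] unfolding g_def by auto
    have "(\<lambda>n. (1 / 2) ^ Suc n *\<^sub>R g n) sums t" unfolding t_def by (rule summable_sums[OF summ])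
    then have "(\<lambda>n. (1 / 2) ^ Suc (n + k) *\<^sub>R g (n + k)) sums (t - s k)"
      unfolding s_sum by (rule sums_split_initial_segment)
    then have "(\<lambda>n. 2 ^ k *\<^sub>R (1 / 2) ^ Suc (n + k) *\<^sub>R g (n + k)) sums (r k)"
      unfolding r_def by (rule sums_scaleR_right)
    moreover have "2 ^ k *\<^sub>R (1 / 2) ^ Suc (n + k) *\<^sub>R g (n + k) = (1 / 2) ^ Suc n *\<^sub>R g (n + k)" for n
      by (simp add: power_add power_divide)
    ultimately show "(\<lambda>n. (1 / 2) ^ Suc n *\<^sub>R g (n + k)) sums (r k)" by (simp only:)
  qed
  have tr: "t = s k + (1 / 2) ^ k *\<^sub>R r k" for k by (simp add: r_def power_divide)
  have "t \<in> closure (convex hull (range S))" using rC[of 0] by (simp add: r_def s0 C0)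
  then obtain \<phi> where \<phi>: "bounded_linear \<phi>" "\<And>v. \<phi> v \<le> norm v" "\<phi> t = norm t" "(\<lambda>n. \<phi> (S n)) \<longlonglongrightarrow> 0"
    using attain by blast
  interpret \<phi>: bounded_linear \<phi> by (rule \<phi>(1))
  have step: "\<phi> (r k) \<le> \<phi> (r (Suc k)) + 2 ^ k * \<epsilon> k" for k
  proof -
    have double: "2 ^ Suc k *\<^sub>R v = 2 ^ k *\<^sub>R v + 2 ^ k *\<^sub>R v" for v :: 'a
      by (simp flip: scaleR_left_distrib)
    have "\<phi> (s k + (1 / 2) ^ k *\<^sub>R g k) \<le> \<phi> t + \<epsilon> k"
      using \<phi>(2)[of "s k + (1 / 2) ^ k *\<^sub>R g k"] G(2)[OF rC[of k], of "s k"] tr[of k] \<phi>(3)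
      by (simp add: g_def)
    moreover have "r k = r (Suc k) + 2 ^ k *\<^sub>R (s k + (1 / 2) ^ k *\<^sub>R g k - t)"
      using double[of t] double[of "s k"]
      by (simp add: r_def sSuc algebra_simps power_divide)
    ultimately show ?thesis
      by (simp add: \<phi>.add \<phi>.diff \<phi>.scaleR mult_left_mono)
  qed
  have low: "e / 2 + e / 2 * (1 / 2) ^ k \<le> \<phi> (r k)" for k
  proof (induction k)
    case 0
    have "e \<le> norm t" using far rC[of 0] by (simp add: r_def s0)
    then show ?case using \<phi>(3) by (simp add: r_def s0)
  next
    case (Suc k)
    have "2 ^ k * \<epsilon> k = e / 4 * (1 / 2) ^ k"
      by (simp add: \<epsilon>_def power_divide field_simps flip: power_mult_distrib)
    then show ?case using step[of k] Suc.IH by simp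
  qed
  obtain k where k: "\<And>n. k \<le> n \<Longrightarrow> \<phi> (S n) < e / 2"
    using order_tendstoD(2)[OF \<phi>(4), of "e / 2"] e unfolding eventually_sequentially by auto
  have "\<phi> (r k) \<le> e / 2"
  proof (rule closed_convex_hull_le_functional[OF \<phi>(1)])
    show "r k \<in> closure (convex hull (S ` {k..}))" using rC[of k] by (simp add: C_def)
    show "\<phi> v \<le> e / 2" if "v \<in> S ` {k..}" for v using that k by (auto intro: less_imp_le)
  qed
  moreover have "0 < e / 2 * (1 / 2) ^ k" using e by simp
  ultimately show False using low[of k] by linarith
qed

section \<open>Compact operators\<close>

lemma compact_operatorI:
  assumes "compact K" "\<And>x. norm x \<le> 1 \<Longrightarrow> blinfun_apply T x \<in> K"
  shows "compact_operator T"
proof -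
  have "closure (blinfun_apply T ` cball 0 1) \<subseteq> K"
    using assms by (intro closure_minimal compact_imp_closed) auto
  then show ?thesis unfolding compact_operator_def
    using assms(1) compact_Int_closed[OF assms(1) closed_closure] by (metis inf.absorb2)
qed

lemma compact_operator_image:
  assumes "compact_operator T" "norm x \<le> 1"
  shows "blinfun_apply T x \<in> closure (blinfun_apply T ` cball 0 1)"
  using assms(2) closure_subset by fastforce

lemma compact_operator_zero: "compact_operator 0"
  by (rule compact_operatorI[of "{0}"]) auto

lemma compact_operator_add:
  assumes "compact_operator T" "compact_operator U"
  shows "compact_operator (T + U)"
proof (rule compact_operatorI)
  let ?K = "closure (blinfun_apply T ` cball 0 1)" and ?L = "closure (blinfun_apply U ` cball 0 1)"
  show "compact {x + y | x y. x \<in> ?K \<and> y \<in> ?L}"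
    using assms unfolding compact_operator_def by (rule compact_sums)
  show "blinfun_apply (T + U) x \<in> {x + y | x y. x \<in> ?K \<and> y \<in> ?L}" if "norm x \<le> 1" for x
    using assms[THEN compact_operator_image] that unfolding blinfun.add_left by blast
qed

lemma compact_operator_scaleR:
  assumes "compact_operator T"
  shows "compact_operator (c *\<^sub>R T)"
proof (rule compact_operatorI)
  show "compact ((\<lambda>x. c *\<^sub>R x) ` closure (blinfun_apply T ` cball 0 1))"
    using assms unfolding compact_operator_def by (rule compact_scaling)
qed (use assms[THEN compact_operator_image] in \<open>auto simp: blinfun.scaleR_left\<close>)

lemma compact_operator_sum:
  assumes "\<And>i. i \<in> I \<Longrightarrow> compact_operator (T i)"
  shows "compact_operator (\<Sum>i\<in>I. T i)"
  using assms by (induction I rule: infinite_finite_induct)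
    (auto intro: compact_operator_zero compact_operator_add)

lemma compact_operator_compose_left:
  assumes "compact_operator T"
  shows "compact_operator (U o\<^sub>L T)"
proof (rule compact_operatorI)
  show "compact (blinfun_apply U ` closure (blinfun_apply T ` cball 0 1))"
    using assms unfolding compact_operator_def
    by (intro compact_continuous_image linear_continuous_on blinfun.bounded_linear_right)
qed (use compact_operator_image[OF assms] in auto)

text \<open>The inner operator is first scaled to map the unit ball into the unit ball; the divisor is
  \<open>norm U + 1\<close> so that it is never zero.\<close>

lemma compact_operator_compose_right:
  assumes "compact_operator T"
  shows "compact_operator (T o\<^sub>L U)"
proof -
  have "compact_operator (T o\<^sub>L (1 / (norm U + 1)) *\<^sub>R U)"
  proof (rule compact_operatorI)
    show "compact (closure (blinfun_apply T ` cball 0 1))"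
      using assms unfolding compact_operator_def .
    fix x :: 'c assume x: "norm x \<le> 1"
    have "norm (blinfun_apply U x) \<le> norm U * 1"
      using norm_blinfun[of U x] mult_left_mono[OF x norm_ge_zero[of U]] by linarith
    then have "norm (blinfun_apply ((1 / (norm U + 1)) *\<^sub>R U) x) \<le> 1"
      by (simp add: blinfun.scaleR_left divide_le_eq_1)
        (smt (verit) norm_ge_zero)
    then show "blinfun_apply (T o\<^sub>L (1 / (norm U + 1)) *\<^sub>R U) x \<in> closure (blinfun_apply T ` cball 0 1)"
      using compact_operator_image[OF assms] by simp
  qed
  then have "compact_operator ((norm U + 1) *\<^sub>R (T o\<^sub>L (1 / (norm U + 1)) *\<^sub>R U))"
    by (rule compact_operator_scaleR)
  moreover have "(norm U + 1) *\<^sub>R (T o\<^sub>L (1 / (norm U + 1)) *\<^sub>R U) = T o\<^sub>L U"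
    by (rule blinfun_eqI)
      (simp add: blinfun.scaleR_left blinfun.scaleR_right add_nonneg_eq_0_iff
        add.commute[of _ 1] add_pos_nonneg less_imp_neq[symmetric])
  ultimately show ?thesis by simp
qed

lemma compact_operator_rank_one:
  fixes T :: "'a::banach \<Rightarrow>\<^sub>L 'b::banach"
  assumes T: "\<And>x. blinfun_apply T x \<in> range (\<lambda>c. c *\<^sub>R v)"
  shows "compact_operator T"
proof (cases "v = 0")
  case True
  then have "T = 0" using T by (intro blinfun_eqI) auto
  then show ?thesis by (simp add: compact_operator_zero)
next
  case False
  let ?b = "norm T / norm v"
  show ?thesis
  proof (rule compact_operatorI)
    show "compact ((\<lambda>c. c *\<^sub>R v) ` {-?b..?b})"
      by (intro compact_continuous_image continuous_intros) auto
    fix x :: 'a assume x: "norm x \<le> 1"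
    obtain c where c: "blinfun_apply T x = c *\<^sub>R v" using T by blast
    have "norm (blinfun_apply T x) \<le> norm T"
      using norm_blinfun[of T x] mult_left_mono[OF x norm_ge_zero[of T]] by simp
    then have "\<bar>c\<bar> \<le> ?b" using False by (simp add: c field_simps)
    then show "blinfun_apply T x \<in> (\<lambda>c. c *\<^sub>R v) ` {-?b..?b}" using c by (auto simp: abs_le_iff)
  qed
qed

lemma compact_operator_norm_limit:
  fixes T :: "'a::banach \<Rightarrow>\<^sub>L 'b::banach"
  assumes approx: "\<And>e. 0 < e \<Longrightarrow> \<exists>K. compact_operator K \<and> norm (K - T) < e"
  shows "compact_operator T"
  unfolding compact_operator_def compact_eq_totally_bounded
proof (intro conjI allI impI)
  show "complete (closure (blinfun_apply T ` cball 0 1))" by (simp add: complete_eq_closed)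
  fix e :: real assume e: "0 < e"
  obtain K where K: "compact_operator K" "norm (K - T) < e / 3" using approx[of "e / 3"] e by auto
  obtain F where F: "finite F" "closure (blinfun_apply K ` cball 0 1) \<subseteq> (\<Union>x\<in>F. ball x (e / 3))"
    using K(1) e unfolding compact_operator_def compact_eq_totally_bounded
    by (meson divide_pos_pos zero_less_numeral)
  have "blinfun_apply T ` cball 0 1 \<subseteq> (\<Union>x\<in>F. cball x (2 * e / 3))"
  proof clarsimp
    fix y :: 'a assume y: "norm y \<le> 1"
    obtain x where x: "x \<in> F" "dist x (blinfun_apply K y) < e / 3"
      using compact_operator_image[OF K(1) y] F(2) by auto
    have "dist (blinfun_apply K y) (blinfun_apply T y) \<le> norm (K - T)"
      using norm_blinfun[of "K - T" y] mult_left_mono[OF y norm_ge_zero[of "K - T"]]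
      by (simp add: dist_norm blinfun.diff_left)
    then have "dist x (blinfun_apply T y) \<le> 2 * e / 3"
      using dist_triangle[of x "blinfun_apply T y" "blinfun_apply K y"] x(2) K(2) by linarith
    then show "\<exists>x\<in>F. dist x (blinfun_apply T y) * 3 \<le> 2 * e" using x(1) by (auto simp: field_simps)
  qed
  then have "closure (blinfun_apply T ` cball 0 1) \<subseteq> (\<Union>x\<in>F. cball x (2 * e / 3))"
    using F(1) by (intro closure_minimal closed_UN) auto
  also have "\<dots> \<subseteq> (\<Union>x\<in>F. ball x e)" using e by (intro UN_mono) auto
  finally show "\<exists>k. finite k \<and> closure (blinfun_apply T ` cball 0 1) \<subseteq> (\<Union>x\<in>k. ball x e)"
    using F(1) by blast
qed

section \<open>Positive operators and the modulus\<close>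

lemma positive_operatorD: "positive_operator T \<Longrightarrow> 0 \<le> x \<Longrightarrow> 0 \<le> blinfun_apply T x"
  by (simp add: positive_operator_def)

lemma positive_operator_mono:
  "positive_operator T \<Longrightarrow> x \<le> y \<Longrightarrow> blinfun_apply T x \<le> blinfun_apply T y"
  using positive_operatorD[of T "y - x"] by (simp add: blinfun.diff_right)

lemma positive_operator_zero: "positive_operator 0"
  by (simp add: positive_operator_def)

lemma positive_operator_add:
  "positive_operator T \<Longrightarrow> positive_operator U \<Longrightarrow> positive_operator (T + U)"
  by (simp add: positive_operator_def blinfun.add_left)

lemma positive_operator_scaleR:
  "positive_operator T \<Longrightarrow> 0 \<le> c \<Longrightarrow> positive_operator (c *\<^sub>R T)"
  by (simp add: positive_operator_def blinfun.scaleR_left scaleR_nonneg_nonneg)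

lemma positive_operator_compose:
  "positive_operator T \<Longrightarrow> positive_operator U \<Longrightarrow> positive_operator (T o\<^sub>L U)"
  by (simp add: positive_operator_def)

lemma positive_imp_regular: "positive_operator T \<Longrightarrow> T \<in> regular_operators"
  unfolding regular_operators_def using positive_operator_zero by force

lemma regular_operators_diff:
  assumes "T \<in> regular_operators" "U \<in> regular_operators"
  shows "T - U \<in> regular_operators"
proof -
  obtain P Q P' Q' where "T = P - Q" "U = P' - Q'" and pos: "positive_operator P"
    "positive_operator Q" "positive_operator P'" "positive_operator Q'"
    using assms unfolding regular_operators_def by blast
  then have "T - U = (P + Q') - (Q + P')" by simp
  then show ?thesis
    unfolding regular_operators_def using pos positive_operator_add by blast
qed

lemma regular_operators_add:
  assumes "T \<in> regular_operators" "U \<in> regular_operators"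
  shows "T + U \<in> regular_operators"
proof -
  have "0 - U \<in> regular_operators"
    using assms(2) positive_imp_regular[OF positive_operator_zero] regular_operators_diff by blast
  then show ?thesis using regular_operators_diff[OF assms(1), of "0 - U"] by simp
qed

lemma norm_abs [simp]: "norm \<bar>x\<bar> = norm x" for x :: "'a::banach_lattice"
  by (intro antisym norm_mono_abs) simp_all

lemma norm_mono_nonneg: "0 \<le> x \<Longrightarrow> x \<le> y \<Longrightarrow> norm x \<le> norm y" for x y :: "'a::banach_lattice"
  by (intro norm_mono_abs) (simp add: order_trans[of 0 x y])

text \<open>Two-sided domination of \<open>R\<close> by \<open>U\<close> is used at \<open>pprt x\<close> through \<open>U - R\<close> and at the
  negative part through \<open>U + R\<close>, and added up.\<close>

lemma operator_dominated_le:
  assumes "positive_operator (U - R)" "positive_operator (U + R)"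
  shows "blinfun_apply R x \<le> blinfun_apply U \<bar>x\<bar>"
proof -
  have "0 \<le> blinfun_apply (U - R) (pprt x) + blinfun_apply (U + R) (- nprt x)"
    using assms by (intro add_nonneg_nonneg positive_operatorD) auto
  also have "\<dots> = blinfun_apply U (pprt x - nprt x) - blinfun_apply R (pprt x + nprt x)"
    by (simp add: blinfun.diff_left blinfun.add_left blinfun.diff_right blinfun.add_right
      blinfun.minus_right)
  also have "\<dots> = blinfun_apply U \<bar>x\<bar> - blinfun_apply R x"
    by (simp flip: abs_prts prts)
  finally show ?thesis by simp
qed

lemma operator_dominated_abs:
  assumes "positive_operator (U - R)" "positive_operator (U + R)"
  shows "\<bar>blinfun_apply R x\<bar> \<le> blinfun_apply U \<bar>x\<bar>"
  using operator_dominated_le[OF assms, of x] operator_dominated_le[of U "- R" x] assms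
  by (intro abs_leI) (auto simp: blinfun.minus_left)

lemma operator_dominated_norm:
  assumes "positive_operator (U - R)" "positive_operator (U + R)"
  shows "norm R \<le> norm U"
proof (rule norm_blinfun_bound)
  fix x
  have "norm (blinfun_apply R x) \<le> norm (blinfun_apply U \<bar>x\<bar>)"
    using operator_dominated_abs[OF assms, of x] by (intro norm_mono_abs) (meson abs_ge_self order_trans)
  also have "\<dots> \<le> norm U * norm x" using norm_blinfun[of U "\<bar>x\<bar>"] by simp
  finally show "norm (blinfun_apply R x) \<le> norm U * norm x" .
qed simp

lemma positive_operator_attains_norm_nonneg:
  assumes U: "positive_operator U" and "attains_norm U"
  obtains x where "0 \<le> x" "norm x \<le> 1" "norm (blinfun_apply U x) = norm U"
proof -
  obtain x where x: "norm x \<le> 1" "norm (blinfun_apply U x) = norm U"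
    using assms(2) unfolding attains_norm_def by blast
  have "\<bar>blinfun_apply U x\<bar> \<le> blinfun_apply U \<bar>x\<bar>"
    using operator_dominated_abs[of U U x] U positive_operator_zero positive_operator_add[OF U U] by simp
  then have "norm U \<le> norm (blinfun_apply U \<bar>x\<bar>)"
    unfolding x(2)[symmetric] by (intro norm_mono_abs) (meson abs_ge_self order_trans)
  moreover have "norm (blinfun_apply U \<bar>x\<bar>) \<le> norm U"
    using norm_blinfun[of U "\<bar>x\<bar>"] mult_left_mono[OF x(1) norm_ge_zero[of U]] by simp
  ultimately show ?thesis using that[of "\<bar>x\<bar>"] x(1) by simp
qed

text \<open>Kantorovich's lemma: an additive, positively homogeneous map between the positive cones is
  extended by differences.  Its boundedness is the automatic continuity of positive maps.\<close>

lemma positive_operator_extension: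
  fixes m :: "'a::banach_lattice \<Rightarrow> 'b::banach_lattice"
  assumes nonneg: "\<And>x. 0 \<le> x \<Longrightarrow> 0 \<le> m x"
    and add: "\<And>x y. 0 \<le> x \<Longrightarrow> 0 \<le> y \<Longrightarrow> m (x + y) = m x + m y"
    and scale: "\<And>c x. 0 < c \<Longrightarrow> 0 \<le> x \<Longrightarrow> m (c *\<^sub>R x) = c *\<^sub>R m x"
  obtains M where "positive_operator M" "\<And>x. 0 \<le> x \<Longrightarrow> blinfun_apply M x = m x"
proof -
  define neg where "neg x = - nprt x" for x :: 'a
  have neg0: "0 \<le> neg x" and split: "x = pprt x - neg x" for x
    using prts[of x] by (simp_all add: neg_def)
  define L where "L x = m (pprt x) - m (neg x)" for x
  \<comment> \<open>The value depends only on the difference, so any convenient decomposition may be used.\<close>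
  have L_diff: "L x = m a - m b" if "x = a - b" "0 \<le> a" "0 \<le> b" for x a b
  proof -
    have "a - b = pprt x - neg x" by (rule trans[OF that(1)[symmetric] split])
    then have "pprt x + b = a + neg x" by (simp add: algebra_simps)
    then have "m (pprt x) + m b = m a + m (neg x)"
      using add[of "pprt x" b] add[of a "neg x"] that neg0 by simp
    then show ?thesis by (simp add: L_def algebra_simps)
  qed
  have m0: "m 0 = 0" using add[of 0 0] by simp
  have "linear L"
  proof (rule linearI)
    fix x y :: 'a
    have "x + y = (pprt x - neg x) + (pprt y - neg y)" by (simp only: flip: split)
    also have "\<dots> = (pprt x + pprt y) - (neg x + neg y)" by simp
    finally have "L (x + y) = m (pprt x + pprt y) - m (neg x + neg y)"
      by (rule L_diff) (simp_all add: neg0)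
    then show "L (x + y) = L x + L y"
      using add[of "pprt x" "pprt y"] add[of "neg x" "neg y"] neg0 by (simp add: L_def)
  next
    fix c :: real and x :: 'a
    have cx: "c *\<^sub>R x = c *\<^sub>R pprt x - c *\<^sub>R neg x"
      unfolding scaleR_diff_right[symmetric] by (simp only: flip: split)
    show "L (c *\<^sub>R x) = c *\<^sub>R L x"
    proof (cases c "0::real" rule: linorder_cases)
      case less
      have "c *\<^sub>R x = (- c) *\<^sub>R neg x - (- c) *\<^sub>R pprt x" using cx by simp
      then have "L (c *\<^sub>R x) = m ((- c) *\<^sub>R neg x) - m ((- c) *\<^sub>R pprt x)"
        using less by (intro L_diff scaleR_nonneg_nonneg) (auto simp: neg0)
      also have "\<dots> = c *\<^sub>R L x"
        using scale[of "- c" "neg x"] scale[of "- c" "pprt x"] less neg0[of x]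
        by (simp add: L_def algebra_simps)
      finally show ?thesis .
    next
      case equal then show ?thesis by (simp add: L_def m0 neg_def)
    next
      case greater
      have "L (c *\<^sub>R x) = m (c *\<^sub>R pprt x) - m (c *\<^sub>R neg x)"
        using greater by (intro L_diff[OF cx] scaleR_nonneg_nonneg) (auto simp: neg0)
      also have "\<dots> = c *\<^sub>R L x"
        using scale[of c "neg x"] scale[of c "pprt x"] greater neg0[of x]
        by (simp add: L_def algebra_simps)
      finally show ?thesis .
    qed
  qed
  moreover have L: "L x = m x" if "0 \<le> x" for x using that by (simp add: L_def m0 neg_def)
  ultimately have "bounded_linear L"
    using nonneg by (intro positive_linear_imp_bounded_linear) auto
  then have "blinfun_apply (Blinfun L) = L" by (rule bounded_linear_Blinfun_apply)
  then show ?thesis using that[of "Blinfun L"] L nonneg by (simp add: positive_operator_def)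
qed

lemma Riesz_decomposition:
  fixes u x y :: "'a::banach_lattice"
  assumes "0 \<le> u" "u \<le> x + y" "0 \<le> x" "0 \<le> y"
  obtains v w where "u = v + w" "v \<in> {0..x}" "w \<in> {0..y}"
proof -
  define v where "v = inf u x"
  have "u - y \<le> v" using assms unfolding v_def by (simp add: algebra_simps)
  then have "u = v + (u - v)" "u - v \<in> {0..y}"
    using assms by (auto simp: v_def[symmetric] diff_le_eq add.commute) (simp add: v_def)
  moreover have "v \<in> {0..x}" using assms by (simp add: v_def)
  ultimately show ?thesis using that by blast
qed

lemma cSup_add:
  fixes A B :: "'b::{banach_lattice, conditionally_complete_lattice} set"
  assumes "A \<noteq> {}" "bdd_above A" "B \<noteq> {}" "bdd_above B"
  shows "Sup {a + b | a b. a \<in> A \<and> b \<in> B} = Sup A + Sup B"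
proof (rule cSup_eq_non_empty)
  show "{a + b | a b. a \<in> A \<and> b \<in> B} \<noteq> {}" using assms by blast
  show "s \<le> Sup A + Sup B" if "s \<in> {a + b | a b. a \<in> A \<and> b \<in> B}" for s
    using that assms by (auto intro!: add_mono cSup_upper)
  fix z assume z: "\<And>s. s \<in> {a + b | a b. a \<in> A \<and> b \<in> B} \<Longrightarrow> s \<le> z"
  have "Sup A \<le> z - b" if "b \<in> B" for b
    using assms(1) z that by (intro cSup_least) (auto simp: le_diff_eq)
  then have "Sup B \<le> z - Sup A"
    using assms(3) by (intro cSup_least) (auto simp: algebra_simps)
  then show "Sup A + Sup B \<le> z" by (simp add: algebra_simps)
qed

lemma cSup_scaleR:
  fixes A :: "'b::{banach_lattice, conditionally_complete_lattice} set"
  assumes "A \<noteq> {}" "bdd_above A" "0 < c"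
  shows "Sup ((\<lambda>a. c *\<^sub>R a) ` A) = c *\<^sub>R Sup A"
proof (rule cSup_eq_non_empty)
  show "s \<le> c *\<^sub>R Sup A" if "s \<in> (\<lambda>a. c *\<^sub>R a) ` A" for s
    using that assms by (auto intro!: scaleR_left_mono cSup_upper)
  fix z assume z: "\<And>s. s \<in> (\<lambda>a. c *\<^sub>R a) ` A \<Longrightarrow> s \<le> z"
  have "Sup A \<le> (1 / c) *\<^sub>R z"
  proof (rule cSup_least[OF assms(1)])
    fix a assume "a \<in> A"
    then have "(1 / c) *\<^sub>R (c *\<^sub>R a) \<le> (1 / c) *\<^sub>R z" using z assms(3) by (intro scaleR_left_mono) auto
    then show "a \<le> (1 / c) *\<^sub>R z" using assms(3) by simp
  qed
  then have "c *\<^sub>R Sup A \<le> c *\<^sub>R ((1 / c) *\<^sub>R z)" using assms(3) by (intro scaleR_left_mono) auto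
  then show "c *\<^sub>R Sup A \<le> z" using assms(3) by simp
qed (use assms in auto)

text \<open>The Riesz-Kantorovich formula: on the positive cone, the positive part of \<open>R\<close> is
  \<open>Sup {R u | 0 \<le> u \<le> x}\<close>.  The supremum exists since \<open>R \<le> P\<close> for a positive \<open>P\<close> and the codomain is Dedekind
  complete; it is additive in \<open>x\<close> since the Riesz decomposition splits the order interval of a sum.\<close>

theorem regular_operator_positive_part:
  fixes R :: "'a::banach_lattice \<Rightarrow>\<^sub>L 'b::{banach_lattice, conditionally_complete_lattice}"
  assumes "R \<in> regular_operators"
  obtains M where "positive_operator M" "positive_operator (M - R)"
    "\<And>U. positive_operator U \<Longrightarrow> positive_operator (U - R) \<Longrightarrow> positive_operator (U - M)"
proof -
  obtain P Q where R: "R = P - Q" and P: "positive_operator P" and Q: "positive_operator Q"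
    using assms unfolding regular_operators_def by blast
  define I where "I x = blinfun_apply R ` {0..x}" for x
  have ne: "I x \<noteq> {}" if "0 \<le> x" for x using that by (auto simp: I_def)
  have I0: "0 \<in> I x" and Ix: "blinfun_apply R x \<in> I x" if "0 \<le> x" for x
    using that unfolding I_def by (auto intro!: image_eqI[of _ _ 0])
  have bdd: "bdd_above (I x)" for x
    unfolding I_def
  proof (rule bdd_aboveI2)
    fix u assume u: "u \<in> {0..x}"
    have "blinfun_apply R u \<le> blinfun_apply P u"
      using positive_operatorD[OF Q, of u] u by (simp add: R blinfun.diff_left)
    also have "\<dots> \<le> blinfun_apply P x" using positive_operator_mono[OF P] u by simp
    finally show "blinfun_apply R u \<le> blinfun_apply P x" .
  qed
  have I_add: "I (x + y) = {a + b | a b. a \<in> I x \<and> b \<in> I y}" if xy: "0 \<le> x" "0 \<le> y" for x y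
  proof (intro equalityI subsetI)
    fix v assume "v \<in> I (x + y)"
    then obtain u where u: "0 \<le> u" "u \<le> x + y" "v = blinfun_apply R u" by (auto simp: I_def)
    obtain a b where "u = a + b" "a \<in> {0..x}" "b \<in> {0..y}"
      using Riesz_decomposition[OF u(1,2) xy] by blast
    then show "v \<in> {a + b | a b. a \<in> I x \<and> b \<in> I y}"
      unfolding I_def u(3) by (auto simp: blinfun.add_right intro!: exI imageI)
  next
    fix v assume "v \<in> {a + b | a b. a \<in> I x \<and> b \<in> I y}"
    then obtain a b where "v = blinfun_apply R a + blinfun_apply R b" "a \<in> {0..x}" "b \<in> {0..y}"
      by (auto simp: I_def)
    then show "v \<in> I (x + y)"
      unfolding I_def by (intro image_eqI[of _ _ "a + b"]) (auto simp: blinfun.add_right add_mono)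
  qed
  have I_scale: "I (c *\<^sub>R x) = (\<lambda>a. c *\<^sub>R a) ` I x" if "0 < c" for c x
  proof -
    have "{0..c *\<^sub>R x} = (\<lambda>a. c *\<^sub>R a) ` {0..x}"
    proof (intro equalityI subsetI)
      fix u assume u: "u \<in> {0..c *\<^sub>R x}"
      have "(1 / c) *\<^sub>R u \<le> (1 / c) *\<^sub>R (c *\<^sub>R x)" using u that by (intro scaleR_left_mono) auto
      then have "(1 / c) *\<^sub>R u \<in> {0..x}" using u that by (auto intro: scaleR_nonneg_nonneg)
      moreover have "u = c *\<^sub>R ((1 / c) *\<^sub>R u)" using that by simp
      ultimately show "u \<in> (\<lambda>a. c *\<^sub>R a) ` {0..x}" by blast
    qed (use that in \<open>auto intro!: scaleR_nonneg_nonneg scaleR_left_mono\<close>)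
    then show ?thesis unfolding I_def by (auto simp: image_image blinfun.scaleR_right)
  qed
  obtain M where M: "positive_operator M" "\<And>x. 0 \<le> x \<Longrightarrow> blinfun_apply M x = Sup (I x)"
  proof (rule positive_operator_extension[of "\<lambda>x. Sup (I x)"])
    show "0 \<le> Sup (I x)" if "0 \<le> x" for x using cSup_upper[OF I0 bdd] that .
    show "Sup (I (x + y)) = Sup (I x) + Sup (I y)" if "0 \<le> x" "0 \<le> y" for x y
      using that by (simp add: I_add cSup_add ne bdd)
    show "Sup (I (c *\<^sub>R x)) = c *\<^sub>R Sup (I x)" if "0 < c" "0 \<le> x" for c x
      using that by (simp add: I_scale cSup_scaleR ne bdd)
  qed blast
  show ?thesis
  proof
    show "positive_operator M" by (rule M(1))
    show "positive_operator (M - R)"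
      using cSup_upper[OF Ix bdd] M(2) by (simp add: positive_operator_def blinfun.diff_left)
    fix U assume U: "positive_operator U" "positive_operator (U - R)"
    show "positive_operator (U - M)"
      unfolding positive_operator_def
    proof (intro allI impI)
      fix x :: 'a assume x: "0 \<le> x"
      have "Sup (I x) \<le> blinfun_apply U x"
      proof (rule cSup_least[OF ne[OF x]])
        fix v assume "v \<in> I x"
        then obtain u where u: "0 \<le> u" "u \<le> x" "v = blinfun_apply R u" by (auto simp: I_def)
        have "v \<le> blinfun_apply U u"
          using positive_operatorD[OF U(2) u(1)] u(3) by (simp add: blinfun.diff_left)
        also have "\<dots> \<le> blinfun_apply U x" by (rule positive_operator_mono[OF U(1) u(2)])
        finally show "v \<le> blinfun_apply U x" .
      qed
      then show "0 \<le> blinfun_apply (U - M) x" using M(2)[OF x] by (simp add: blinfun.diff_left)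
    qed
  qed
qed

lemma positive_operator_antisym:
  assumes "positive_operator (T - U)" "positive_operator (U - T)"
  shows "T = U"
proof (rule blinfun_eqI)
  fix x
  have eq: "blinfun_apply T y = blinfun_apply U y" if "0 \<le> y" for y
    using assms that by (auto simp: positive_operator_def blinfun.diff_left intro: antisym)
  have "blinfun_apply T x = blinfun_apply T (pprt x) - blinfun_apply T (- nprt x)"
    "blinfun_apply U x = blinfun_apply U (pprt x) - blinfun_apply U (- nprt x)"
    using prts[of x] by (metis blinfun.diff_right diff_minus_eq_add)+
  then show "blinfun_apply T x = blinfun_apply U x" using eq[of "pprt x"] eq[of "- nprt x"] by simp
qed

text \<open>The supremum of \<open>R\<close> and \<open>- R\<close>.  Competitors range over all operators, since any upper bound of
  both is positive (see \<open>upper_bound_positive\<close>), hence regular.\<close>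

definition is_modulus :: "('a::banach_lattice \<Rightarrow>\<^sub>L 'b::banach_lattice) \<Rightarrow> ('a \<Rightarrow>\<^sub>L 'b) \<Rightarrow> bool" where
  "is_modulus R M \<longleftrightarrow> positive_operator (M - R) \<and> positive_operator (M + R) \<and>
     (\<forall>U. positive_operator (U - R) \<longrightarrow> positive_operator (U + R) \<longrightarrow> positive_operator (U - M))"

lemma upper_bound_positive:
  assumes "positive_operator (U - R)" "positive_operator (U + R)"
  shows "positive_operator U"
proof -
  have "U = (1 / 2) *\<^sub>R ((U - R) + (U + R))" by (simp add: scaleR_2[symmetric])
  then show ?thesis
    using positive_operator_scaleR[OF positive_operator_add[OF assms], of "1 / 2"] by simp
qed

lemma operator_modulus_eqI:
  assumes "is_modulus R M"
  shows "operator_modulus R = M"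
  unfolding operator_modulus_def
proof (rule the_equality)
  have M: "M \<in> regular_operators"
    using assms upper_bound_positive positive_imp_regular unfolding is_modulus_def by blast
  then show "M \<in> regular_operators \<and> positive_operator (M - R) \<and> positive_operator (M - - R) \<and>
     (\<forall>U\<in>regular_operators. positive_operator (U - R) \<and> positive_operator (U - - R)
        \<longrightarrow> positive_operator (U - M))"
    using assms by (simp add: is_modulus_def)
  fix N assume N: "N \<in> regular_operators \<and> positive_operator (N - R) \<and> positive_operator (N - - R) \<and>
     (\<forall>U\<in>regular_operators. positive_operator (U - R) \<and> positive_operator (U - - R)
        \<longrightarrow> positive_operator (U - N))"
  show "N = M"
    using N M assms by (intro positive_operator_antisym) (simp_all add: is_modulus_def)
qed

lemma operator_modulus_positive: "positive_operator R \<Longrightarrow> operator_modulus R = R"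
  by (intro operator_modulus_eqI)
    (simp add: is_modulus_def positive_operator_zero positive_operator_add)

text \<open>With \<open>M\<close> the positive part of \<open>R\<close>, the modulus is \<open>2 M - R\<close>: if \<open>U\<close> dominates \<open>R\<close> and \<open>- R\<close>, then
  half of \<open>U + R\<close> dominates \<open>R\<close> and \<open>0\<close>, hence \<open>M\<close>.\<close>

theorem is_modulus_operator_modulus:
  fixes R :: "'a::banach_lattice \<Rightarrow>\<^sub>L 'b::{banach_lattice, conditionally_complete_lattice}"
  assumes "R \<in> regular_operators"
  shows "is_modulus R (operator_modulus R)"
proof -
  obtain M where M: "positive_operator M" "positive_operator (M - R)"
    "\<And>U. positive_operator U \<Longrightarrow> positive_operator (U - R) \<Longrightarrow> positive_operator (U - M)"
    using regular_operator_positive_part[OF assms] by blast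
  have "is_modulus R (M + (M - R))"
    unfolding is_modulus_def
  proof (intro conjI allI impI)
    have "M + (M - R) - R = (M - R) + (M - R)" by simp
    then show "positive_operator (M + (M - R) - R)" using positive_operator_add[OF M(2) M(2)] by (simp only:)
    have "M + (M - R) + R = M + M" by simp
    then show "positive_operator (M + (M - R) + R)" using positive_operator_add[OF M(1) M(1)] by (simp only:)
    fix U assume U: "positive_operator (U - R)" "positive_operator (U + R)"
    let ?V = "(1 / 2) *\<^sub>R (U + R)"
    have "?V - R = (1 / 2) *\<^sub>R (U - R)"
      by (simp add: algebra_simps flip: scaleR_add_left)
    then have "positive_operator (?V - M)"
      using U by (intro M(3)) (simp_all add: positive_operator_scaleR)
    then have "positive_operator ((?V - M) + (?V - M))" by (simp add: positive_operator_add)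
    moreover have "(?V - M) + (?V - M) = U - (M + (M - R))"
      by (simp add: algebra_simps flip: scaleR_add_left)
    ultimately show "positive_operator (U - (M + (M - R)))" by simp
  qed
  then show ?thesis using operator_modulus_eqI by metis
qed

lemma modulus_dominates:
  fixes R :: "'a::banach_lattice \<Rightarrow>\<^sub>L 'b::{banach_lattice, conditionally_complete_lattice}"
  assumes "R \<in> regular_operators"
  shows "positive_operator (operator_modulus R - R)" "positive_operator (operator_modulus R + R)"
    "positive_operator (operator_modulus R)"
  using is_modulus_operator_modulus[OF assms] upper_bound_positive
  unfolding is_modulus_def by blast+

lemma modulus_least:
  fixes R :: "'a::banach_lattice \<Rightarrow>\<^sub>L 'b::{banach_lattice, conditionally_complete_lattice}"
  assumes "R \<in> regular_operators" "positive_operator (U - R)" "positive_operator (U + R)"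
  shows "positive_operator (U - operator_modulus R)"
  using is_modulus_operator_modulus[OF assms(1)] assms(2,3) unfolding is_modulus_def by blast

lemma modulus_triangle:
  fixes R S :: "'a::banach_lattice \<Rightarrow>\<^sub>L 'b::{banach_lattice, conditionally_complete_lattice}"
  assumes R: "R \<in> regular_operators" and S: "S \<in> regular_operators"
  shows "positive_operator (operator_modulus R + operator_modulus S - operator_modulus (R + S))"
proof (rule modulus_least[OF regular_operators_add[OF R S]])
  show "positive_operator (operator_modulus R + operator_modulus S - (R + S))"
    using positive_operator_add[OF modulus_dominates(1)[OF R] modulus_dominates(1)[OF S]]
    by (simp add: algebra_simps)
  show "positive_operator (operator_modulus R + operator_modulus S + (R + S))"
    using positive_operator_add[OF modulus_dominates(2)[OF R] modulus_dominates(2)[OF S]]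
    by (simp add: algebra_simps)
qed

lemma modulus_norm_triangle:
  fixes R S :: "'a::banach_lattice \<Rightarrow>\<^sub>L 'b::{banach_lattice, conditionally_complete_lattice}"
  assumes R: "R \<in> regular_operators" and S: "S \<in> regular_operators" and x: "0 \<le> x"
  shows "norm (blinfun_apply (operator_modulus (R + S)) x)
    \<le> norm (blinfun_apply (operator_modulus R) x) + norm (blinfun_apply (operator_modulus S) x)"
proof -
  have "blinfun_apply (operator_modulus (R + S)) x
      \<le> blinfun_apply (operator_modulus R) x + blinfun_apply (operator_modulus S) x"
    using positive_operatorD[OF modulus_triangle[OF R S] x]
    by (simp add: blinfun.diff_left blinfun.add_left)
  then have "norm (blinfun_apply (operator_modulus (R + S)) x)
      \<le> norm (blinfun_apply (operator_modulus R) x + blinfun_apply (operator_modulus S) x)"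
    using positive_operatorD[OF modulus_dominates(3)[OF regular_operators_add[OF R S]] x]
    by (rule norm_mono_nonneg[rotated])
  then show ?thesis using norm_triangle_ineq order_trans by blast
qed

section \<open>Convergence in the absolute strong operator topology\<close>

text \<open>The basic neighbourhoods are themselves open, by the triangle inequality for the modulus; so
  convergence in the topology can be tested on them.\<close>

lemma openin_abs_SOT_nbhd:
  fixes T :: "'a::banach_lattice \<Rightarrow>\<^sub>L 'b::{banach_lattice, conditionally_complete_lattice}"
  assumes T: "T \<in> regular_operators" and A: "finite A" "A \<subseteq> {x. 0 \<le> x}"
  shows "openin abs_SOT (abs_SOT_nbhd T A \<epsilon>)"
  unfolding openin_abs_SOT abs_SOT_open_def
proof (intro conjI ballI)
  show "abs_SOT_nbhd T A \<epsilon> \<subseteq> regular_operators" by (auto simp: abs_SOT_nbhd_def)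
  fix S assume S: "S \<in> abs_SOT_nbhd T A \<epsilon>"
  then have Sr: "S \<in> regular_operators" by (simp add: abs_SOT_nbhd_def)
  \<comment> \<open>The \<open>1\<close> keeps the minimum defined when \<open>A\<close> is empty.\<close>
  define D where "D = insert 1 ((\<lambda>x. \<epsilon> - norm (blinfun_apply (operator_modulus (T - S)) x)) ` A)"
  have D: "finite D" "D \<noteq> {}" using A by (auto simp: D_def)
  have "\<forall>d\<in>D. 0 < d" using S by (auto simp: D_def abs_SOT_nbhd_def)
  then have "0 < Min D" using D by simp
  moreover have "abs_SOT_nbhd S A (Min D) \<subseteq> abs_SOT_nbhd T A \<epsilon>"
  proof
    fix U assume U: "U \<in> abs_SOT_nbhd S A (Min D)"
    then have Ur: "U \<in> regular_operators" by (simp add: abs_SOT_nbhd_def)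
    have "norm (blinfun_apply (operator_modulus (T - U)) x) < \<epsilon>" if x: "x \<in> A" for x
    proof -
      have "Min D \<le> \<epsilon> - norm (blinfun_apply (operator_modulus (T - S)) x)"
        using D x by (intro Min_le) (auto simp: D_def)
      moreover have "norm (blinfun_apply (operator_modulus (S - U)) x) < Min D"
        using U x by (simp add: abs_SOT_nbhd_def)
      moreover have "norm (blinfun_apply (operator_modulus (T - U)) x)
          \<le> norm (blinfun_apply (operator_modulus (T - S)) x)
            + norm (blinfun_apply (operator_modulus (S - U)) x)"
        using modulus_norm_triangle[OF regular_operators_diff[OF T Sr] regular_operators_diff[OF Sr Ur], of x]
          A(2) x by auto
      ultimately show ?thesis by linarith
    qed
    then show "U \<in> abs_SOT_nbhd T A \<epsilon>" using Ur by (simp add: abs_SOT_nbhd_def)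
  qed
  ultimately show "\<exists>B \<delta>. finite B \<and> B \<subseteq> {x. 0 \<le> x} \<and> 0 < \<delta> \<and> abs_SOT_nbhd S B \<delta> \<subseteq> abs_SOT_nbhd T A \<epsilon>"
    using A by blast
qed

theorem limitin_abs_SOT_iff:
  fixes T :: "'a::banach_lattice \<Rightarrow>\<^sub>L 'b::{banach_lattice, conditionally_complete_lattice}"
  assumes \<sigma>: "\<And>n. \<sigma> n \<in> regular_operators"
  shows "limitin abs_SOT \<sigma> T sequentially \<longleftrightarrow> T \<in> regular_operators \<and>
    (\<forall>x\<ge>0. (\<lambda>n. blinfun_apply (operator_modulus (T - \<sigma> n)) x) \<longlonglongrightarrow> 0)"
proof (intro iffI conjI allI impI)
  assume lim: "limitin abs_SOT \<sigma> T sequentially"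
  then show T: "T \<in> regular_operators" by (simp add: limitin_def topspace_abs_SOT)
  fix x :: 'a assume x: "0 \<le> x"
  show "(\<lambda>n. blinfun_apply (operator_modulus (T - \<sigma> n)) x) \<longlonglongrightarrow> 0"
  proof (rule tendstoI)
    fix e :: real assume e: "0 < e"
    have "T \<in> abs_SOT_nbhd T {x} e"
      using T e by (simp add: abs_SOT_nbhd_def operator_modulus_positive positive_operator_zero)
    then have "eventually (\<lambda>n. \<sigma> n \<in> abs_SOT_nbhd T {x} e) sequentially"
      using lim openin_abs_SOT_nbhd[OF T, of "{x}" e] x by (simp add: limitin_def)
    then show "eventually (\<lambda>n. dist (blinfun_apply (operator_modulus (T - \<sigma> n)) x) 0 < e) sequentially"
      by eventually_elim (simp add: abs_SOT_nbhd_def)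
  qed
next
  assume R: "T \<in> regular_operators \<and>
    (\<forall>x\<ge>0. (\<lambda>n. blinfun_apply (operator_modulus (T - \<sigma> n)) x) \<longlonglongrightarrow> 0)"
  show "limitin abs_SOT \<sigma> T sequentially"
    unfolding limitin_def
  proof (intro conjI allI impI)
    show "T \<in> topspace abs_SOT" using R by (simp add: topspace_abs_SOT)
    fix U assume "openin abs_SOT U \<and> T \<in> U"
    then obtain A e where A: "finite A" "A \<subseteq> {x. 0 \<le> x}" "0 < e" "abs_SOT_nbhd T A e \<subseteq> U"
      unfolding openin_abs_SOT abs_SOT_open_def by meson
    have "eventually (\<lambda>n. \<forall>x\<in>A. norm (blinfun_apply (operator_modulus (T - \<sigma> n)) x) < e) sequentially"
      using A R by (intro eventually_ball_finite ballI) (auto simp: tendsto_iff)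
    then show "eventually (\<lambda>n. \<sigma> n \<in> U) sequentially"
      by eventually_elim (use A(4) \<sigma> in \<open>auto simp: abs_SOT_nbhd_def\<close>)
  qed
qed

section \<open>From norm attainment to sequential closedness\<close>

lemma closed_convex_positive_operators:
  "closed (Collect (positive_operator :: ('a::banach_lattice \<Rightarrow>\<^sub>L 'b::banach_lattice) \<Rightarrow> bool))"
  "convex (Collect (positive_operator :: ('a::banach_lattice \<Rightarrow>\<^sub>L 'b::banach_lattice) \<Rightarrow> bool))"
proof -
  show "closed (Collect (positive_operator :: ('a \<Rightarrow>\<^sub>L 'b) \<Rightarrow> bool))"
    unfolding closed_sequential_limits
  proof (intro allI impI)
    fix X and T :: "'a \<Rightarrow>\<^sub>L 'b"
    assume X: "(\<forall>n. X n \<in> Collect positive_operator) \<and> X \<longlonglongrightarrow> T"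
    have "0 \<le> blinfun_apply T x" if "0 \<le> x" for x
    proof (rule nonneg_closed)
      show "(\<lambda>n. blinfun_apply (X n) x) \<longlonglongrightarrow> blinfun_apply T x"
        by (rule blinfun.tendsto[OF conjunct2[OF X] tendsto_const])
      show "0 \<le> blinfun_apply (X n) x" for n using X that by (simp add: positive_operator_def)
    qed
    then show "T \<in> Collect positive_operator" by (simp add: positive_operator_def)
  qed
  show "convex (Collect (positive_operator :: ('a \<Rightarrow>\<^sub>L 'b) \<Rightarrow> bool))"
    unfolding convex_def by (auto intro: positive_operator_add positive_operator_scaleR)
qed

text \<open>A point at which an operator attains its norm, paired with a functional that norms its image,
  is a functional on the operator space that norms the operator.  This is how norm attainment meets
  the hypothesis of \<open>convex_combinations_approach_zero\<close>.\<close>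

lemma evaluation_functional:
  fixes s :: "'a::real_normed_vector \<Rightarrow>\<^sub>L 'b::real_normed_vector"
  assumes x: "norm x \<le> 1" "norm (blinfun_apply s x) = norm s"
  obtains \<phi> where "bounded_linear \<phi>" "\<And>v. \<phi> v \<le> norm v" "\<phi> s = norm s"
    "\<And>v. \<bar>\<phi> v\<bar> \<le> norm (blinfun_apply v x)"
proof -
  obtain g :: "'b \<Rightarrow>\<^sub>L real" where g: "norm g \<le> 1" "blinfun_apply g (blinfun_apply s x) = norm (blinfun_apply s x)"
    by (rule norming_functional)
  define \<phi> where "\<phi> v = blinfun_apply g (blinfun_apply v x)" for v
  have le: "\<bar>\<phi> v\<bar> \<le> norm (blinfun_apply v x)" for v
    using norm_blinfun[of g "blinfun_apply v x"] mult_right_mono[OF g(1), of "norm (blinfun_apply v x)"]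
    by (simp add: \<phi>_def)
  have "\<phi> v \<le> norm v" for v
    using le[of v] norm_blinfun[of v x] mult_left_mono[OF x(1), of "norm v"] by simp
  moreover have "bounded_linear \<phi>" unfolding \<phi>_def by (intro bounded_linear_intros)
  ultimately show ?thesis using that[of \<phi>] le g(2) x(2) by (simp add: \<phi>_def)
qed

text \<open>Let \<open>\<sigma> n\<close> tend to \<open>T\<close> and put \<open>S n = |T - \<sigma> n|\<close>.  The closed convex hull of the \<open>S n\<close> consists of positive
  operators; each attains its norm, and does so at a positive vector \<open>x\<close>, where \<open>S n x\<close> tends to zero by the definition of the
  topology.  So convex combinations of the \<open>S n\<close> become small in norm.  The matching convex combination
  \<open>K\<close> of the compact operators \<open>\<sigma> n\<close> satisfies \<open>|T - K| \<le> g\<close>, where \<open>g\<close> is that combination of the \<open>S n\<close>; so \<open>T\<close> is a norm limit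
  of compact operators.\<close>

theorem compact_unit_ball_sequentially_closed:
  assumes att: "\<And>T :: 'a::banach_lattice \<Rightarrow>\<^sub>L 'b::{banach_lattice, conditionally_complete_lattice}.
    positive_operator T \<Longrightarrow> attains_norm T"
  shows "sequentially_closedin (abs_SOT :: ('a \<Rightarrow>\<^sub>L 'b) topology) positive_compact_unit_ball"
  unfolding sequentially_closedin_def
proof (intro conjI allI impI)
  show "(positive_compact_unit_ball :: ('a \<Rightarrow>\<^sub>L 'b) set) \<subseteq> topspace abs_SOT"
    by (auto simp: topspace_abs_SOT positive_compact_unit_ball_def positive_imp_regular)
  fix \<sigma> and T :: "'a \<Rightarrow>\<^sub>L 'b"
  assume asm: "(\<forall>n. \<sigma> n \<in> positive_compact_unit_ball) \<and> limitin abs_SOT \<sigma> T sequentially"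
  then have pos: "positive_operator (\<sigma> n)" and cpt: "compact_operator (\<sigma> n)" and nrm: "norm (\<sigma> n) \<le> 1" for n
    by (auto simp: positive_compact_unit_ball_def)
  define S where "S n = operator_modulus (T - \<sigma> n)" for n
  have T: "T \<in> regular_operators" and S0: "\<And>x. 0 \<le> x \<Longrightarrow> (\<lambda>n. blinfun_apply (S n) x) \<longlonglongrightarrow> 0"
    using asm limitin_abs_SOT_iff[of \<sigma> T] positive_imp_regular[OF pos] by (auto simp: S_def)
  note reg = regular_operators_diff[OF T positive_imp_regular[OF pos]]
  have S: "positive_operator (S n - (T - \<sigma> n))" "positive_operator (S n + (T - \<sigma> n))"
    "positive_operator (S n)" for n
    unfolding S_def by (rule modulus_dominates[OF reg])+
  have lim: "(\<lambda>n. blinfun_apply (\<sigma> n) x) \<longlonglongrightarrow> blinfun_apply T x" for x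
  proof -
    have le: "norm (blinfun_apply T x - blinfun_apply (\<sigma> n) x) \<le> norm (blinfun_apply (S n) \<bar>x\<bar>)" for n
      unfolding blinfun.diff_left[symmetric] using operator_dominated_abs[OF S(1,2), of n x]
      by (intro norm_mono_abs) (meson abs_ge_self order_trans)
    have "(\<lambda>n. norm (blinfun_apply (S n) \<bar>x\<bar>)) \<longlonglongrightarrow> 0"
      by (rule tendsto_norm_zero[OF S0]) simp
    then have "(\<lambda>n. blinfun_apply T x - blinfun_apply (\<sigma> n) x) \<longlonglongrightarrow> 0"
      by (rule Lim_null_comparison[OF always_eventually[OF allI[OF le]]])
    then have "(\<lambda>n. blinfun_apply T x - (blinfun_apply T x - blinfun_apply (\<sigma> n) x)) \<longlonglongrightarrow> blinfun_apply T x - 0"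
      by (intro tendsto_diff tendsto_const)
    then show ?thesis by simp
  qed
  have Tpos: "positive_operator T"
    unfolding positive_operator_def using nonneg_closed[OF lim] positive_operatorD[OF pos] by blast
  have Tnorm: "norm T \<le> 1"
  proof (rule norm_blinfun_bound)
    fix x
    have "norm (blinfun_apply (\<sigma> n) x) \<le> 1 * norm x" for n
      using norm_blinfun[of "\<sigma> n" x] mult_right_mono[OF nrm[of n] norm_ge_zero[of x]] by linarith
    then show "norm (blinfun_apply T x) \<le> 1 * norm x"
      by (intro LIMSEQ_le_const2[OF tendsto_norm[OF lim]]) auto
  qed simp
  \<comment> \<open>Since \<open>T\<close> and \<open>\<sigma> n\<close> are positive, \<open>|T - \<sigma> n| \<le> T + \<sigma> n\<close>.\<close>
  have bdd: "norm (S n) \<le> 2" for n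
  proof -
    have "positive_operator (T + \<sigma> n - S n)"
      unfolding S_def
    proof (rule modulus_least[OF reg])
      have "T + \<sigma> n - (T - \<sigma> n) = \<sigma> n + \<sigma> n" "T + \<sigma> n + (T - \<sigma> n) = T + T" by simp_all
      then show "positive_operator (T + \<sigma> n - (T - \<sigma> n))" "positive_operator (T + \<sigma> n + (T - \<sigma> n))"
        using positive_operator_add[OF pos pos] positive_operator_add[OF Tpos Tpos] by (simp_all only:)
    qed
    then have "norm (S n) \<le> norm (T + \<sigma> n)"
      by (rule operator_dominated_norm) (simp add: positive_operator_add Tpos pos S)
    also have "\<dots> \<le> 2" using norm_triangle_ineq[of T "\<sigma> n"] Tnorm nrm[of n] by simp
    finally show ?thesis .
  qed
  have attain: "\<exists>\<phi>. bounded_linear \<phi> \<and> (\<forall>v. \<phi> v \<le> norm v) \<and> \<phi> s = norm s \<and> (\<lambda>n. \<phi> (S n)) \<longlonglongrightarrow> 0"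
    if s: "s \<in> closure (convex hull (range S))" for s
  proof -
    have "convex hull (range S) \<subseteq> Collect positive_operator"
      using S(3) by (intro hull_minimal closed_convex_positive_operators) auto
    then have "closure (convex hull (range S)) \<subseteq> Collect positive_operator"
      by (intro closure_minimal closed_convex_positive_operators)
    then have "positive_operator s" using s by blast
    then obtain x where x: "0 \<le> x" "norm x \<le> 1" "norm (blinfun_apply s x) = norm s"
      using positive_operator_attains_norm_nonneg att by blast
    obtain \<phi> where \<phi>: "bounded_linear \<phi>" "\<And>v. \<phi> v \<le> norm v" "\<phi> s = norm s"
      "\<And>v. \<bar>\<phi> v\<bar> \<le> norm (blinfun_apply v x)"
      using evaluation_functional[OF x(2,3)] by blast
    have "norm (\<phi> (S n)) \<le> norm (blinfun_apply (S n) x)" for n using \<phi>(4) by simp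
    then have "(\<lambda>n. \<phi> (S n)) \<longlonglongrightarrow> 0"
      by (rule Lim_null_comparison[OF always_eventually[OF allI] tendsto_norm_zero[OF S0[OF x(1)]]])
    then show ?thesis using \<phi> by blast
  qed
  \<comment> \<open>The set of all such \<open>g\<close> is convex and contains every \<open>S n\<close>, so no coefficients of
    convex combinations have to be named.\<close>
  have dominate: "\<exists>K. compact_operator K \<and> positive_operator (g - (T - K)) \<and> positive_operator (g + (T - K))"
    if g: "g \<in> convex hull (range S)" for g
  proof -
    let ?C = "{g. \<exists>K. compact_operator K \<and> positive_operator (g - (T - K)) \<and> positive_operator (g + (T - K))}"
    have "convex ?C"
    proof (rule convexI)
      fix g h and u v :: real assume gh: "g \<in> ?C" "h \<in> ?C" and uv: "0 \<le> u" "0 \<le> v" "u + v = 1"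
      then obtain K L where K: "compact_operator K" "positive_operator (g - (T - K))" "positive_operator (g + (T - K))"
        and L: "compact_operator L" "positive_operator (h - (T - L))" "positive_operator (h + (T - L))" by blast
      have T: "T = u *\<^sub>R T + v *\<^sub>R T" using uv(3) by (simp flip: scaleR_add_left)
      let ?M = "u *\<^sub>R K + v *\<^sub>R L"
      have "u *\<^sub>R g + v *\<^sub>R h - (u *\<^sub>R T + v *\<^sub>R T - ?M) = u *\<^sub>R (g - (T - K)) + v *\<^sub>R (h - (T - L))"
        "u *\<^sub>R g + v *\<^sub>R h + (u *\<^sub>R T + v *\<^sub>R T - ?M) = u *\<^sub>R (g + (T - K)) + v *\<^sub>R (h + (T - L))"
        by (simp_all add: algebra_simps)
      then have "positive_operator (u *\<^sub>R g + v *\<^sub>R h - (T - ?M))" "positive_operator (u *\<^sub>R g + v *\<^sub>R h + (T - ?M))"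
        unfolding T[symmetric]
        using K L uv by (simp_all only: positive_operator_add positive_operator_scaleR)
      then show "u *\<^sub>R g + v *\<^sub>R h \<in> ?C"
        using compact_operator_add compact_operator_scaleR K(1) L(1) by blast
    qed
    moreover have "range S \<subseteq> ?C" using S cpt by blast
    ultimately have "convex hull (range S) \<subseteq> ?C" by (intro hull_minimal)
    then show ?thesis using g by blast
  qed
  have "compact_operator T"
  proof (rule compact_operator_norm_limit)
    fix e :: real assume "0 < e"
    then obtain g where g: "g \<in> convex hull (range S)" "norm g < e"
      using convex_combinations_approach_zero[of S, OF bdd attain] by blast
    obtain K where K: "compact_operator K" "positive_operator (g - (T - K))" "positive_operator (g + (T - K))"
      using dominate[OF g(1)] by blast
    have "norm (K - T) < e" using operator_dominated_norm[OF K(2,3)] g(2) by (simp add: norm_minus_commute)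
    then show "\<exists>K. compact_operator K \<and> norm (K - T) < e" using K(1) by blast
  qed
  then show "T \<in> positive_compact_unit_ball"
    using Tpos Tnorm by (simp add: positive_compact_unit_ball_def)
qed

section \<open>Orders given by a basis\<close>

text \<open>When the order is coordinatewise, the basis vectors and the coordinates of positive vectors are
  nonnegative, so the coordinate projections are positive, and are bounded for that reason alone.\<close>

theorem order_basis_projections:
  assumes "order_given_by_basis TYPE('a::banach_lattice)"
  obtains P :: "nat \<Rightarrow> 'a::banach_lattice \<Rightarrow>\<^sub>L 'a" where
    "\<And>n. positive_operator (P n)" "\<And>n. positive_operator (id_blinfun - P n)"
    "\<And>n. compact_operator (P n)" "\<And>v. (\<lambda>n. blinfun_apply (P n) v) \<longlonglongrightarrow> v"
proof -
  obtain x :: "nat \<Rightarrow> 'a" where basis: "schauder_basis x"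
    and order': "\<forall>a b. summable (\<lambda>n. a n *\<^sub>R x n) \<and> summable (\<lambda>n. b n *\<^sub>R x n) \<longrightarrow>
      ((\<Sum>n. a n *\<^sub>R x n) \<le> (\<Sum>n. b n *\<^sub>R x n) \<longleftrightarrow> (\<forall>n. a n \<le> b n))"
    using assms unfolding order_given_by_basis_def by (elim exE conjE)
  have order: "v \<le> w \<longleftrightarrow> (\<forall>n. a n \<le> b n)"
    if "(\<lambda>n. a n *\<^sub>R x n) sums v" "(\<lambda>n. b n *\<^sub>R x n) sums w" for a b v w
    using order'[rule_format, of a b] that by (simp add: sums_iff)
  have unique_coords: "\<exists>!a. (\<lambda>n. a n *\<^sub>R x n) sums v" for v
    using basis by (simp add: schauder_basis_def)
  define c where "c v = (THE a. (\<lambda>n. a n *\<^sub>R x n) sums v)" for v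
  have c: "(\<lambda>n. c v n *\<^sub>R x n) sums v" for v
    unfolding c_def by (rule theI'[OF unique_coords])
  have uniq: "b = c v" if "(\<lambda>n. b n *\<^sub>R x n) sums v" for b v
    using that c[of v] unique_coords[of v] by (elim ex1E) metis
  have zero: "(\<lambda>n. 0 *\<^sub>R x n) sums 0" by simp
  have c_add: "c (v + w) n = c v n + c w n" for v w n
  proof -
    have "(\<lambda>n. (c v n + c w n) *\<^sub>R x n) sums (v + w)"
      unfolding scaleR_add_left by (rule sums_add[OF c c])
    from fun_cong[OF uniq[OF this], of n] show ?thesis by (rule sym)
  qed
  have c_scale: "c (r *\<^sub>R v) n = r * c v n" for r v n
  proof -
    have "(\<lambda>n. (r * c v n) *\<^sub>R x n) sums (r *\<^sub>R v)"
      unfolding scaleR_scaleR[symmetric] by (rule sums_scaleR_right[OF c])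
    from fun_cong[OF uniq[OF this], of n] show ?thesis by (rule sym)
  qed
  have c_nonneg: "0 \<le> c v n" if "0 \<le> v" for v n
    using order[OF zero c[of v]] that by simp
  have x_nonneg: "0 \<le> x n" for n
  proof -
    have "(\<lambda>k. (if k = n then 1 else 0) *\<^sub>R x k) = (\<lambda>k. if k = n then x k else 0)"
      by auto
    then have "(\<lambda>k. (if k = n then 1 else 0) *\<^sub>R x k) sums x n"
      using sums_single[of n x] by simp
    from order[OF zero this] show ?thesis by simp
  qed
  define Q where "Q n = Blinfun (\<lambda>v. c v n *\<^sub>R x n)" for n
  have Q: "blinfun_apply (Q n) v = c v n *\<^sub>R x n" for n v
  proof -
    have "bounded_linear (\<lambda>v. c v n *\<^sub>R x n)"
      by (intro positive_linear_imp_bounded_linear linearI)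
        (auto simp: c_add c_scale scaleR_add_left c_nonneg x_nonneg scaleR_nonneg_nonneg)
    then show ?thesis unfolding Q_def by (simp add: bounded_linear_Blinfun_apply)
  qed
  define P where "P n = (\<Sum>k<n. Q k)" for n
  have P: "blinfun_apply (P n) v = (\<Sum>k<n. c v k *\<^sub>R x k)" for n v
    by (simp add: P_def blinfun.sum_left Q)
  have lim: "(\<lambda>n. blinfun_apply (P n) v) \<longlonglongrightarrow> v" for v
    using c[of v] unfolding P sums_def .
  show ?thesis
  proof
    show "positive_operator (P n)" for n
      unfolding positive_operator_def P
      by (auto intro!: sum_nonneg scaleR_nonneg_nonneg c_nonneg x_nonneg)
    show "compact_operator (P n)" for n
      unfolding P_def by (intro compact_operator_sum compact_operator_rank_one) (auto simp: Q)
    show "(\<lambda>n. blinfun_apply (P n) v) \<longlonglongrightarrow> v" for v by (rule lim)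
    show "positive_operator (id_blinfun - P n)" for n
      unfolding positive_operator_def
    proof (intro allI impI)
      fix v :: 'a assume v: "0 \<le> v"
      \<comment> \<open>\<open>v - P n v\<close> is the limit of the partial sums of its nonnegative tail.\<close>
      have "(\<lambda>m. blinfun_apply (P (m + n)) v - blinfun_apply (P n) v) \<longlonglongrightarrow> v - blinfun_apply (P n) v"
        by (intro tendsto_diff tendsto_const LIMSEQ_ignore_initial_segment lim)
      moreover have "0 \<le> blinfun_apply (P (m + n)) v - blinfun_apply (P n) v" for m
        unfolding P by (simp, intro sum_mono2)
          (auto intro!: scaleR_nonneg_nonneg c_nonneg x_nonneg v)
      ultimately have "0 \<le> v - blinfun_apply (P n) v" by (rule nonneg_closed)
      then show "0 \<le> blinfun_apply (id_blinfun - P n) v" by (simp add: blinfun.diff_left)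
    qed
  qed
qed

text \<open>For \<open>0 \<le> K n \<le> T\<close> the modulus of \<open>T - K n\<close> is the operator itself, so strong convergence already is
  convergence in the absolute strong operator topology; and \<open>norm (K n) \<le> norm T\<close>, so after scaling the \<open>K n\<close> lie
  in the unit ball.\<close>

lemma compact_of_compact_minorants:
  fixes T :: "'a::banach_lattice \<Rightarrow>\<^sub>L 'b::{banach_lattice, conditionally_complete_lattice}"
  assumes closed: "sequentially_closedin (abs_SOT :: ('a \<Rightarrow>\<^sub>L 'b) topology) positive_compact_unit_ball"
    and T: "positive_operator T"
    and K: "\<And>n. positive_operator (K n)" "\<And>n. positive_operator (T - K n)" "\<And>n. compact_operator (K n)"
    and lim: "\<And>x. (\<lambda>n. blinfun_apply (K n) x) \<longlonglongrightarrow> blinfun_apply T x"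
  shows "compact_operator T"
proof -
  define r where "r = 1 / (norm T + 1)"
  have pos: "0 < norm T + 1" by (simp add: add_nonneg_pos)
  then have r: "0 < r" by (simp add: r_def)
  have "norm (r *\<^sub>R K n) \<le> 1" for n
  proof -
    have "norm (K n) \<le> norm T"
      using K T by (intro operator_dominated_norm positive_operator_add) auto
    then show ?thesis using pos by (simp add: r_def field_simps)
  qed
  then have mem: "r *\<^sub>R K n \<in> positive_compact_unit_ball" for n
    using K r by (simp add: positive_compact_unit_ball_def positive_operator_scaleR compact_operator_scaleR)
  have "operator_modulus (r *\<^sub>R T - r *\<^sub>R K n) = r *\<^sub>R (T - K n)" for n
    using operator_modulus_positive[OF positive_operator_scaleR[OF K(2), of r n]] r
    by (simp add: scaleR_diff_right)
  moreover have "(\<lambda>n. blinfun_apply (r *\<^sub>R (T - K n)) x) \<longlonglongrightarrow> 0" for x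
    using tendsto_scaleR[OF tendsto_const tendsto_diff[OF tendsto_const lim], of r "blinfun_apply T x" x]
    by (simp add: blinfun.scaleR_left blinfun.diff_left)
  moreover have "r *\<^sub>R T \<in> regular_operators" "r *\<^sub>R K n \<in> regular_operators" for n
    using K(1) T r by (simp_all add: positive_imp_regular positive_operator_scaleR)
  ultimately have "limitin abs_SOT (\<lambda>n. r *\<^sub>R K n) (r *\<^sub>R T) sequentially"
    by (simp add: limitin_abs_SOT_iff)
  then have "r *\<^sub>R T \<in> positive_compact_unit_ball"
    using conjunct2[OF closed[unfolded sequentially_closedin_def], rule_format,
        of "\<lambda>n. r *\<^sub>R K n" "r *\<^sub>R T"] mem by simp
  then have "compact_operator (r *\<^sub>R T)" by (simp add: positive_compact_unit_ball_def)
  then have "compact_operator ((1 / r) *\<^sub>R (r *\<^sub>R T))" by (rule compact_operator_scaleR)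
  then show ?thesis using r by simp
qed

section \<open>Compactness, norm attainment and sequential closedness\<close>

theorem theorem2p12:
  assumes reflexive: "reflexive_space TYPE('e::banach_lattice)"
  shows
    "((\<forall>T :: 'e \<Rightarrow>\<^sub>L 'f::{banach_lattice, conditionally_complete_lattice}.
          positive_operator T \<longrightarrow> compact_operator T)
        \<longrightarrow> (\<forall>T :: 'e \<Rightarrow>\<^sub>L 'f. positive_operator T \<longrightarrow> attains_norm T))
     \<and>
     ((\<forall>T :: 'e \<Rightarrow>\<^sub>L 'f. positive_operator T \<longrightarrow> attains_norm T)
        \<longrightarrow> sequentially_closedin (abs_SOT :: ('e \<Rightarrow>\<^sub>L 'f) topology) positive_compact_unit_ball)
     \<and>
     (order_given_by_basis TYPE('e) \<or>
        (order_continuous_norm TYPE('f) \<and> order_given_by_basis TYPE('f))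
        \<longrightarrow> sequentially_closedin (abs_SOT :: ('e \<Rightarrow>\<^sub>L 'f) topology) positive_compact_unit_ball
        \<longrightarrow> (\<forall>T :: 'e \<Rightarrow>\<^sub>L 'f. positive_operator T \<longrightarrow> compact_operator T))"
proof (intro conjI impI allI)
  fix T :: "'e \<Rightarrow>\<^sub>L 'f"
  assume "\<forall>T :: 'e \<Rightarrow>\<^sub>L 'f. positive_operator T \<longrightarrow> compact_operator T" "positive_operator T"
  then show "attains_norm T"
    using reflexive_compact_operator_attains_norm[OF reflexive] by blast
next
  assume "\<forall>T :: 'e \<Rightarrow>\<^sub>L 'f. positive_operator T \<longrightarrow> attains_norm T"
  then show "sequentially_closedin (abs_SOT :: ('e \<Rightarrow>\<^sub>L 'f) topology) positive_compact_unit_ball"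
    using compact_unit_ball_sequentially_closed by blast
next
  fix T :: "'e \<Rightarrow>\<^sub>L 'f"
  assume basis: "order_given_by_basis TYPE('e) \<or>
      (order_continuous_norm TYPE('f) \<and> order_given_by_basis TYPE('f))"
    and closed: "sequentially_closedin (abs_SOT :: ('e \<Rightarrow>\<^sub>L 'f) topology) positive_compact_unit_ball"
    and T: "positive_operator T"
  from basis consider (domain) "order_given_by_basis TYPE('e)" | (codomain) "order_given_by_basis TYPE('f)"
    by blast
  then show "compact_operator T"
  proof cases
    case domain
    then obtain P :: "nat \<Rightarrow> 'e \<Rightarrow>\<^sub>L 'e" where P: "\<And>n. positive_operator (P n)"
      "\<And>n. positive_operator (id_blinfun - P n)" "\<And>n. compact_operator (P n)"
      "\<And>v. (\<lambda>n. blinfun_apply (P n) v) \<longlonglongrightarrow> v"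
      using order_basis_projections by blast
    show ?thesis
    proof (rule compact_of_compact_minorants[OF closed T])
      show "positive_operator (T o\<^sub>L P n)" for n by (rule positive_operator_compose[OF T P(1)])
      have "T - (T o\<^sub>L P n) = T o\<^sub>L (id_blinfun - P n)" for n
        by (rule blinfun_eqI) (simp add: blinfun.diff_left blinfun.diff_right)
      then show "positive_operator (T - (T o\<^sub>L P n))" for n
        using positive_operator_compose[OF T P(2)] by simp
      show "compact_operator (T o\<^sub>L P n)" for n by (rule compact_operator_compose_left[OF P(3)])
      show "(\<lambda>n. blinfun_apply (T o\<^sub>L P n) x) \<longlonglongrightarrow> blinfun_apply T x" for x
        using blinfun.tendsto[OF tendsto_const P(4), of T x] by simp
    qed
  next
    case codomain
    then obtain P :: "nat \<Rightarrow> 'f \<Rightarrow>\<^sub>L 'f" where P: "\<And>n. positive_operator (P n)"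
      "\<And>n. positive_operator (id_blinfun - P n)" "\<And>n. compact_operator (P n)"
      "\<And>v. (\<lambda>n. blinfun_apply (P n) v) \<longlonglongrightarrow> v"
      using order_basis_projections by blast
    show ?thesis
    proof (rule compact_of_compact_minorants[OF closed T])
      show "positive_operator (P n o\<^sub>L T)" for n by (rule positive_operator_compose[OF P(1) T])
      have "T - (P n o\<^sub>L T) = (id_blinfun - P n) o\<^sub>L T" for n
        by (rule blinfun_eqI) (simp add: blinfun.diff_left)
      then show "positive_operator (T - (P n o\<^sub>L T))" for n
        using positive_operator_compose[OF P(2) T] by simp
      show "compact_operator (P n o\<^sub>L T)" for n by (rule compact_operator_compose_right[OF P(3)])
      show "(\<lambda>n. blinfun_apply (P n o\<^sub>L T) x) \<longlonglongrightarrow> blinfun_apply T x" for x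
        using P(4) by simp
    qed
  qed
qed

end
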